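(* Let $(V,H,V')$ be a normal triple of Hilbert spaces, $T>0$, let $\mathbf{A}:V\to V'$ be a bounded linear operator satisfying assumption (A) stated in the context, and let $\mathbf{M}_k:V\to V'$, $k\ge 1$, be bounded linear operators. Let $C_k$ be numbers such that $$\int_0^T\Big\|\int_0^t\Phi_{t-s}\mathbf M_kv(s)\,ds\Big\|_V^2dt\le C_k^2\|v\|_{\mathcal V}^2\quad\text{for all }v\in\mathcal V.$$ Suppose $u_0\in H$ and $f\in\mathcal V'$ are non-random, and let $u=\sum_{\alpha}u_\alpha\xi_\alpha$ be the solution of $$\dot u(t)=\mathbf A u(t)+f(t)+\sum_{k\ge1}(\mathbf M_k u(t))\diamond\xi_k,\quad 0<t\le T,\qquad u|_{t=0}=u_0 .$$ Let $u_{(0)}(t)=\Phi_tu_0+\int_0^t\Phi_{t-s}f(s)ds$. Then: (1) For $\alpha$ with $|\alpha|=n\ge1$ and characteristic set $K_\alpha=\{k_1,\dots,k_n\}$, $$u_\alpha(t)=\frac1{\sqrt{\alpha!}}\sum_{\sigma\in\mathcal P_n}\int_0^t\int_0^{s_n}\!\!\cdots\int_0^{s_2}\Phi_{t-s_n}\mathbf M_{k_{\sigma(n)}}\cdots\Phi_{s_2-s_1}\mathbf M_{k_{\sigma(1)}}u_{(0)}(s_1)\,ds_1\dots ds_n,$$ where $\mathcal P_n$ is the permutation group of $(1,\dots,n)$. (2) $u\in\mathcal RL_2(\mathbb F;\mathcal V)$ with the weights $$r_\alpha=\frac{q^\alpha}{\sqrt{|\alpha|!}},\qquad q^\alpha=\prod_{k\ge1}q_k^{\alpha_k},$$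 whenever the positive numbers $q_k$ are chosen so that $\sum_{k\ge1}q_k^2C_k^2<1$. (3) With such $q_k$ and $r_\alpha$, and with $\overline{\mathbf M}=(q_1\mathbf M_1,q_2\mathbf M_2,\dots)$, for every $n\ge1$ $$\sum_{|\alpha|=n}q^\alpha u_\alpha(t)\xi_\alpha=\int_0^t\int_0^{s_n}\!\!\cdots\int_0^{s_2}\Phi_{t-s_n}\delta\big(\overline{\mathbf M}\Phi_{s_n-s_{n-1}}\delta(\cdots\delta(\overline{\mathbf M}u_{(0)}(s_1)))\cdots\big)ds_1\dots ds_{n-1}ds_n,$$ and $$\mathcal Ru(t)=u_{(0)}(t)+\sum_{n=1}^\infty\frac1{\sqrt{n!}}\int_0^t\int_0^{s_n}\!\!\cdots\int_0^{s_2}\Phi_{t-s_n}\delta\big(\overline{\mathbf M}\Phi_{s_n-s_{n-1}}\delta(\cdots\delta(\overline{\mathbf M}u_{(0)}(s_1)))\cdots\big)ds_1\dots ds_{n-1}ds_n.$$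
   Context: Wiener chaos. $\mathbb F=(\Omega,\mathcal F,\mathbb P)$ is a complete probability space, $\mathcal U$ a real separable Hilbert space with orthonormal basis $\{\mathfrak u_k\}_{k\ge1}$, $\dot W=\{\dot W(h),h\in\mathcal U\}$ a zero-mean Gaussian family with $\mathbb E(\dot W(h_1)\dot W(h_2))=(h_1,h_2)_{\mathcal U}$, and $\mathcal F$ is generated by $\dot W$. Put $\xi_k=\dot W(\mathfrak u_k)$. $\mathcal J$ is the set of multi-indices $\alpha=(\alpha_1,\alpha_2,\dots)$ of non-negative integers with $|\alpha|=\sum_k\alpha_k<\infty$; $\alpha!=\prod_k\alpha_k!$; $(0)$ is the zero multi-index; $\varepsilon_k$ has $1$ in position $k$ and $0$ elsewhere. $\xi_\alpha=\prod_k H_{\alpha_k}(\xi_k)/\sqrt{\alpha_k!}$, $H_n(x)=(-1)^ne^{x^2/2}\frac{d^n}{dx^n}e^{-x^2/2}$. The characteristic set $K_\alpha$ of $\alpha$ with $|\alpha|=n\geq 1$ is the ordered $n$-tuple $k_1\le\dots\le k_n$ in which each index $k$ is repeated $\alpha_k$ times. Weighted spaces. For positive weights $\{r_\alpha\}_{\alpha\in\mathcal J}$ and a Hilbert space $X$, $\mathcal R L_2(\mathbb F;X)$ is the space of formal series $v=\sum_{\alpha}v_\alpha\xi_\alpha$, $v_\alpha\in X$, with $\sum_\alpha r_\alpha^2\|v_\alpha\|_X^2<\infty$, and $\mathcal Rv=\sum_\alpha r_\alpha v_\alpha\xi_\alpha$. Normal triple: dense continuous embeddings $V\hookrightarrow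 H\hookrightarrow V'$, $V'$ is the dual of $V$ relative to the inner product of $H$, and $|(h,v)_H|\le C\|v\|_V\|h\|_{V'}$ for $v\in V,h\in H$. $\mathcal V=L_2((0,T);V)$, $\mathcal V'=L_2((0,T);V')$. Assumption (A): for every $U_0\in H$ and $F\in\mathcal V'$ there exists $U\in\mathcal V$ solving $\partial_tU(t)=\mathbf AU(t)+F(t)$, $U(0)=U_0$, and there is a constant $C(\mathbf A,T)$ such that every such solution satisfies $\|U\|_{\mathcal V}\le C(\mathbf A,T)(\|U_0\|_H+\|F\|_{\mathcal V'})$ (in particular the solution is unique). $\Phi=\Phi_t$ is the semigroup generated by $\mathbf A$; $\Phi_tU_0+\int_0^t\Phi_{t-s}F(s)ds$ denotes the solution $U(t)$ of this equation. Iterated integrals are understood as successive applications of $v\mapsto\int_0^{\cdot}\Phi_{\cdot-s}\mathbf M_kv(s)ds$ on $\mathcal V$. The operator $\delta$: for a formal series $v=\sum_\alpha v_\alpha\xi_\alpha$ with coefficients in $V$, $\delta(\overline{\mathbf M}v)=\sum_kq_k(\mathbf M_kv)\diamond\xi_k$ is the formal series whose $\alpha$-th coefficient is $\sum_{k}\sqrt{\alpha_k}\,q_k\mathbf M_kv_{\alpha-\varepsilon_k}$ (terms with $\alpha_k=0$ are zero); $\Phi_t$ and time integrals act coefficientwise on formal series. Solution: $u=\sum_\alpha u_\alpha\xi_\alpha$, with $u_\alpha\in\mathcal V\cap\mathbf C([0,T];H)$, such that in $V'$, for all $t\in[0,T]$ and $\alpha\in\mathcal J$, $$u_\alpha(t)=u_0I_{(\alpha=(0))}+\int_0^t\Big(\mathbf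 Au_\alpha(s)+f(s)I_{(\alpha=(0))}+\sum_{k\ge1}\sqrt{\alpha_k}\,\mathbf M_ku_{\alpha-\varepsilon_k}(s)\Big)ds,$$ and this system determines $u$ uniquely. *)

theory Defs
  imports "HOL-Probability.Probability" "HOL-Library.Poly_Mapping" "HOL-Combinatorics.Permutations"
begin

text \<open>Multi-indices. The index \<open>k \<ge> 1\<close> of the noise is shifted to range over all of \<^typ>\<open>nat\<close>;
  finitely supported maps are exactly the sequences with finite length.\<close>

type_synonym midx = "nat \<Rightarrow>\<^sub>0 nat"

definition mabs :: "midx \<Rightarrow> nat" where
  "mabs \<alpha> = (\<Sum>k\<in>Poly_Mapping.keys \<alpha>. Poly_Mapping.lookup \<alpha> k)"

definition mfact :: "midx \<Rightarrow> real" where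
  "mfact \<alpha> = (\<Prod>k\<in>Poly_Mapping.keys \<alpha>. fact (Poly_Mapping.lookup \<alpha> k))"

definition mpow :: "(nat \<Rightarrow> real) \<Rightarrow> midx \<Rightarrow> real" where
  "mpow q \<alpha> = (\<Prod>k\<in>Poly_Mapping.keys \<alpha>. q k ^ Poly_Mapping.lookup \<alpha> k)"

abbreviation meps :: "nat \<Rightarrow> midx" where
  "meps k \<equiv> Poly_Mapping.single k 1"

definition charset :: "midx \<Rightarrow> nat list" where
  "charset \<alpha> = concat (map (\<lambda>k. replicate (Poly_Mapping.lookup \<alpha> k) k)
     (sorted_list_of_set (Poly_Mapping.keys \<alpha>)))"


definition orthonormal_basis :: "(nat \<Rightarrow> 'u::real_inner) \<Rightarrow> bool" where
  "orthonormal_basis b \<longleftrightarrow>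
     (\<forall>k l. inner (b k) (b l) = (if k = l then 1 else 0)) \<and> closure (span (range b)) = UNIV"

text \<open>Zero-mean Gaussian variables may be degenerate.\<close>

definition centered_gaussian :: "'o measure \<Rightarrow> ('o \<Rightarrow> real) \<Rightarrow> bool" where
  "centered_gaussian M X \<longleftrightarrow> X \<in> borel_measurable M \<and>
     ((AE \<omega> in M. X \<omega> = 0) \<or>
      (\<exists>\<sigma>>0. distributed M lborel X (\<lambda>x. ennreal (normal_density 0 \<sigma> x))))"

text \<open>On a complete probability space, ``generated by the noise'' means: the completion of the
  sigma-algebra generated by the variables \<open>W h\<close>.\<close>

definition gaussian_noise :: "'o measure \<Rightarrow> ('u::real_inner \<Rightarrow> 'o \<Rightarrow> real) \<Rightarrow> bool" where
  "gaussian_noise M W \<longleftrightarrow> prob_space M \<and> complete_measure M \<and>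
     (\<forall>S c. finite S \<longrightarrow> centered_gaussian M (\<lambda>\<omega>. \<Sum>h\<in>S. c h * W h \<omega>)) \<and>
     (\<forall>h1 h2. (LINT \<omega>|M. W h1 \<omega> * W h2 \<omega>) = inner h1 h2) \<and>
     sets M = sets (completion (restr_to_subalg M
       (sigma (space M) {W h -` B \<inter> space M | h B. B \<in> sets borel})))"

definition hermite :: "nat \<Rightarrow> real \<Rightarrow> real" where
  "hermite n x = (-1) ^ n * exp (x\<^sup>2 / 2) * (deriv ^^ n) (\<lambda>y. exp (- (y\<^sup>2) / 2)) x"

definition xi :: "('u \<Rightarrow> 'o \<Rightarrow> real) \<Rightarrow> (nat \<Rightarrow> 'u) \<Rightarrow> midx \<Rightarrow> 'o \<Rightarrow> real" where
  "xi W b \<alpha> \<omega> = (\<Prod>k\<in>Poly_Mapping.keys \<alpha>.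
     hermite (Poly_Mapping.lookup \<alpha> k) (W (b k) \<omega>) / sqrt (fact (Poly_Mapping.lookup \<alpha> k)))"


text \<open>A formal series (no convergence is implied) is the family of its coefficients, each paired
  with the basis variable it multiplies; two series are equal iff all coefficients are.\<close>

type_synonym ('x, 'o) fseries = "midx \<Rightarrow> 'x \<times> ('o \<Rightarrow> real)"

definition chaos_series :: "(midx \<Rightarrow> 'o \<Rightarrow> real) \<Rightarrow> (midx \<Rightarrow> 'x) \<Rightarrow> ('x, 'o) fseries" where
  "chaos_series \<xi> v = (\<lambda>\<alpha>. (v \<alpha>, \<xi> \<alpha>))"

text \<open>The space \<open>X\<close> is given by its carrier and its norm. The unweighted space of
  square-integrable variables is the case of constant weight 1.\<close>

definition RL2 :: "(midx \<Rightarrow> 'o \<Rightarrow> real) \<Rightarrow> (midx \<Rightarrow> real) \<Rightarrow> 'x set \<Rightarrow> ('x \<Rightarrow> real)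
    \<Rightarrow> ('x, 'o) fseries set" where
  "RL2 \<xi> r X nX = {chaos_series \<xi> v | v.
     (\<forall>\<alpha>. v \<alpha> \<in> X) \<and> (\<lambda>\<alpha>. (r \<alpha>)\<^sup>2 * (nX (v \<alpha>))\<^sup>2) summable_on UNIV}"

definition RL2_norm :: "(midx \<Rightarrow> real) \<Rightarrow> ('x \<Rightarrow> real) \<Rightarrow> ('x, 'o) fseries \<Rightarrow> real" where
  "RL2_norm r nX S = sqrt (\<Sum>\<^sub>\<infinity>\<alpha>. (r \<alpha>)\<^sup>2 * (nX (fst (S \<alpha>)))\<^sup>2)"


text \<open>Normal triple with embeddings \<open>i\<close> of \<open>V\<close> into \<open>H\<close> and \<open>j\<close> of \<open>H\<close> into \<open>V'\<close>, which is
  the dual of \<open>V\<close> relative to the inner product of \<open>H\<close>: a continuous pairing that extends this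
  inner product represents every bounded functional on \<open>V\<close> by exactly one element of \<open>V'\<close>.\<close>

definition normal_triple ::
  "('v::{real_inner, complete_space} \<Rightarrow> 'h::{real_inner, complete_space})
   \<Rightarrow> ('h \<Rightarrow> 'w::{real_inner, complete_space}) \<Rightarrow> bool" where
  "normal_triple i j \<longleftrightarrow>
     bounded_linear i \<and> inj i \<and> closure (range i) = UNIV \<and>
     bounded_linear j \<and> inj j \<and> closure (range j) = UNIV \<and>
     (\<exists>p :: 'w \<Rightarrow> 'v \<Rightarrow> real. bounded_bilinear p \<and>
        (\<forall>h v. p (j h) v = inner h (i v)) \<and>
        (\<forall>\<phi>. bounded_linear \<phi> \<longrightarrow> (\<exists>!w. \<forall>v. p w v = \<phi> v))) \<and>
     (\<exists>C. \<forall>v h. \<bar>inner h (i v)\<bar> \<le> C * norm v * norm (j h))"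


text \<open>Bochner spaces over (0,T) for Hilbert spaces that need not be separable, hence strong
  measurability rather than Borel measurability. Elements are represented by functions.\<close>

definition strongly_measurable :: "'a measure \<Rightarrow> ('a \<Rightarrow> 'b::topological_space) \<Rightarrow> bool" where
  "strongly_measurable M f \<longleftrightarrow>
     (\<exists>s. (\<forall>n. simple_function M (s n)) \<and> (AE x in M. (\<lambda>n. s n x) \<longlonglongrightarrow> f x))"

abbreviation time_measure :: "real \<Rightarrow> real measure" where
  "time_measure T \<equiv> lebesgue_on {0<..<T}"

definition L2_time :: "real \<Rightarrow> (real \<Rightarrow> 'x::real_normed_vector) set" where
  "L2_time T = {v. strongly_measurable (time_measure T) v \<and>
     integrable (time_measure T) (\<lambda>t. (norm (v t))\<^sup>2)}"

definition L2_time_norm :: "real \<Rightarrow> (real \<Rightarrow> 'x::real_normed_vector) \<Rightarrow> real" where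
  "L2_time_norm T v = sqrt (LINT t|time_measure T. (norm (v t))\<^sup>2)"

text \<open>Elements of \<open>L\<^sub>2((0,T);V)\<close> that have a value at every time (such as solutions) are represented
  by \<open>V'\<close>-valued paths \<open>w\<close> with \<open>w t \<in> V\<close> for almost all \<open>t\<close>. Here \<open>e\<close> is the embedding of \<open>V\<close> into
  \<open>V'\<close>, and \<open>toV e w\<close> is the path read as a \<open>V\<close>-valued function, meaningful almost everywhere.\<close>

definition toV :: "('v \<Rightarrow> 'w) \<Rightarrow> (real \<Rightarrow> 'w) \<Rightarrow> real \<Rightarrow> 'v" where
  "toV e w t = inv e (w t)"

definition calV :: "('v::real_normed_vector \<Rightarrow> 'w) \<Rightarrow> real \<Rightarrow> (real \<Rightarrow> 'w) set" where
  "calV e T = {w. (AE t in time_measure T. w t \<in> range e) \<and> toV e w \<in> L2_time T}"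

definition calV_norm :: "('v::real_normed_vector \<Rightarrow> 'w) \<Rightarrow> real \<Rightarrow> (real \<Rightarrow> 'w) \<Rightarrow> real" where
  "calV_norm e T w = L2_time_norm T (toV e w)"


text \<open>\<open>w\<close> solves \<open>\<partial>\<^sub>t U = A U + F\<close>, \<open>U(0) = g\<close> in \<open>V'\<close>. The integrands are strongly measurable with
  square-integrable norm, so the gauge integral used here is their Bochner integral.\<close>

definition evol_solution ::
  "('v::real_normed_vector \<Rightarrow> 'w::real_normed_vector) \<Rightarrow> real \<Rightarrow> ('v \<Rightarrow> 'w) \<Rightarrow> 'w
   \<Rightarrow> (real \<Rightarrow> 'w) \<Rightarrow> (real \<Rightarrow> 'w) \<Rightarrow> bool" where
  "evol_solution e T A g F w \<longleftrightarrow> w \<in> calV e T \<and>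
     (\<forall>t\<in>{0..T}. ((\<lambda>s. A (toV e w s) + F s) has_integral (w t - g)) {0..t})"

definition assumption_A ::
  "('v::real_normed_vector \<Rightarrow> 'h::real_normed_vector) \<Rightarrow> ('h \<Rightarrow> 'w::real_normed_vector)
   \<Rightarrow> real \<Rightarrow> ('v \<Rightarrow> 'w) \<Rightarrow> bool" where
  "assumption_A i j T A \<longleftrightarrow>
     (\<forall>U0. \<forall>F\<in>L2_time T. \<exists>w. evol_solution (j \<circ> i) T A (j U0) F w) \<and>
     (\<exists>C. \<forall>U0. \<forall>F\<in>L2_time T. \<forall>w. evol_solution (j \<circ> i) T A (j U0) F w \<longrightarrow>
        calV_norm (j \<circ> i) T w \<le> C * (norm U0 + L2_time_norm T F))"

text \<open>\<open>duhamel e T A g F\<close> is the path \<open>t \<mapsto> \<Phi>\<^sub>t g + \<integral>\<^sub>0\<^sup>t \<Phi>\<^bsub>t-s\<^esub> F(s) ds\<close>, that is, the solution of the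
  evolution equation (set to 0 outside [0,T] to make it a unique function).\<close>

definition duhamel ::
  "('v::real_normed_vector \<Rightarrow> 'w::real_normed_vector) \<Rightarrow> real \<Rightarrow> ('v \<Rightarrow> 'w) \<Rightarrow> 'w
   \<Rightarrow> (real \<Rightarrow> 'w) \<Rightarrow> real \<Rightarrow> 'w" where
  "duhamel e T A g F = (THE w. evol_solution e T A g F w \<and> (\<forall>t. t \<notin> {0..T} \<longrightarrow> w t = 0))"

definition Phi_conv ::
  "('v::real_normed_vector \<Rightarrow> 'w::real_normed_vector) \<Rightarrow> real \<Rightarrow> ('v \<Rightarrow> 'w)
   \<Rightarrow> (real \<Rightarrow> 'w) \<Rightarrow> real \<Rightarrow> 'w" where
  "Phi_conv e T A F = duhamel e T A 0 F"

text \<open>\<open>iter_int e T A M [k\<^sub>1, \<dots>, k\<^sub>n] w\<close> is the iterated integral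
  \<open>t \<mapsto> \<integral>\<^sub>0\<^sup>t \<dots> \<integral> \<Phi>\<^bsub>t-s\<^sub>n\<^esub> M\<^bsub>k\<^sub>n\<^esub> \<dots> \<Phi>\<^bsub>s\<^sub>2-s\<^sub>1\<^esub> M\<^bsub>k\<^sub>1\<^esub> w(s\<^sub>1) ds\<^sub>1 \<dots> ds\<^sub>n\<close>: the head of the list acts first.\<close>

definition iter_int ::
  "('v::real_normed_vector \<Rightarrow> 'w::real_normed_vector) \<Rightarrow> real \<Rightarrow> ('v \<Rightarrow> 'w) \<Rightarrow> (nat \<Rightarrow> 'v \<Rightarrow> 'w)
   \<Rightarrow> nat list \<Rightarrow> (real \<Rightarrow> 'w) \<Rightarrow> real \<Rightarrow> 'w" where
  "iter_int e T A M ks w = fold (\<lambda>k w'. Phi_conv e T A (\<lambda>s. M k (toV e w' s))) ks w"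


definition delta :: "(nat \<Rightarrow> 'v \<Rightarrow> 'w::real_vector) \<Rightarrow> (midx \<Rightarrow> 'v) \<Rightarrow> midx \<Rightarrow> 'w" where
  "delta M v \<alpha> = (\<Sum>k\<in>Poly_Mapping.keys \<alpha>.
     sqrt (real (Poly_Mapping.lookup \<alpha> k)) *\<^sub>R M k (v (\<alpha> - meps k)))"

text \<open>\<open>n\<close>-fold iterate, coefficient by coefficient, of
  \<open>v \<mapsto> \<integral>\<^sub>0\<^sup>\<cdot> \<Phi>\<^bsub>\<cdot>-s\<^esub> \<delta>(M v(s)) ds\<close>, started from the deterministic path \<open>w\<close>.\<close>

definition iter_delta ::
  "('v::real_normed_vector \<Rightarrow> 'w::real_normed_vector) \<Rightarrow> real \<Rightarrow> ('v \<Rightarrow> 'w) \<Rightarrow> (nat \<Rightarrow> 'v \<Rightarrow> 'w)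
   \<Rightarrow> (real \<Rightarrow> 'w) \<Rightarrow> nat \<Rightarrow> midx \<Rightarrow> real \<Rightarrow> 'w" where
  "iter_delta e T A M w n =
     ((\<lambda>v \<alpha>. Phi_conv e T A (\<lambda>s. delta M (\<lambda>\<beta>. toV e (v \<beta>) s) \<alpha>)) ^^ n)
       (\<lambda>\<alpha>. if \<alpha> = 0 then w else (\<lambda>t. 0))"

definition spde_solution ::
  "('v::real_normed_vector \<Rightarrow> 'h::real_normed_vector) \<Rightarrow> ('h \<Rightarrow> 'w::real_normed_vector)
   \<Rightarrow> real \<Rightarrow> ('v \<Rightarrow> 'w) \<Rightarrow> (nat \<Rightarrow> 'v \<Rightarrow> 'w) \<Rightarrow> 'h \<Rightarrow> (real \<Rightarrow> 'w)
   \<Rightarrow> (midx \<Rightarrow> real \<Rightarrow> 'h) \<Rightarrow> bool" where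
  "spde_solution i j T A M u0 f u \<longleftrightarrow>
     (\<forall>\<alpha>. continuous_on {0..T} (u \<alpha>) \<and> (\<lambda>t. j (u \<alpha> t)) \<in> calV (j \<circ> i) T \<and>
       (\<forall>t\<in>{0..T}.
         ((\<lambda>s. A (toV (j \<circ> i) (\<lambda>t. j (u \<alpha> t)) s) + (if \<alpha> = 0 then f s else 0)
             + delta M (\<lambda>\<beta>. toV (j \<circ> i) (\<lambda>t. j (u \<beta> t)) s) \<alpha>)
          has_integral (j (u \<alpha> t) - (if \<alpha> = 0 then j u0 else 0))) {0..t}))"

end

theory Submission
  imports Defs "HOL-Combinatorics.Multiset_Permutations"
begin

text \<open>By uniqueness, the coefficients satisfy \<open>u\<^sub>\<alpha> = \<Sum>\<^sub>k \<surd>\<alpha>\<^sub>k \<integral> \<Phi> M\<^sub>k u\<^bsub>\<alpha>-\<epsilon>\<^sub>k\<^esub>\<close>. Unwinding this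
  recursion gives \<open>u\<^sub>\<alpha>\<close> as \<open>\<surd>\<alpha>!\<close> times the sum of the iterated integrals over the distinct
  rearrangements of the characteristic set, each of which arises from exactly \<open>\<alpha>!\<close> permutations.
  For \<open>B\<^sub>\<alpha> = r\<^sub>\<alpha>\<^sup>2 \<parallel>u\<^sub>\<alpha>\<parallel>\<^sup>2\<close> the recursion and Cauchy--Schwarz give
  \<open>B\<^sub>\<alpha> \<le> \<Sum>\<^sub>k q\<^sub>k\<^sup>2 C\<^sub>k\<^sup>2 B\<^bsub>\<alpha>-\<epsilon>\<^sub>k\<^esub>\<close>, so the sums of \<open>B\<^sub>\<alpha>\<close> over the levels \<open>|\<alpha>| = n\<close> decay geometrically.\<close>


section \<open>Square-integrable vector-valued functions\<close>

text \<open>Extension by zero carries both functions to the whole line, where completeness of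
  Lebesgue measure allows a measurable function to be altered on a null set.\<close>

lemma borel_measurable_lebesgue_on_AE:
  fixes f g :: "real \<Rightarrow> real"
  assumes f: "f \<in> borel_measurable (lebesgue_on S)" and S: "S \<in> sets lebesgue"
    and ae: "AE x in lebesgue_on S. f x = g x"
  shows "g \<in> borel_measurable (lebesgue_on S)"
proof -
  have "(\<lambda>x. indicat_real S x *\<^sub>R f x) \<in> borel_measurable lebesgue"
    using f S by (simp add: borel_measurable_restrict_space_iff)
  moreover have "AE x in lebesgue. indicat_real S x *\<^sub>R f x = indicat_real S x *\<^sub>R g x"
    using ae S by (auto simp: AE_restrict_space_iff indicator_def elim!: eventually_mono)
  ultimately have "(\<lambda>x. indicat_real S x *\<^sub>R g x) \<in> borel_measurable lebesgue"
    by (rule borel_measurable_AE)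
  then show ?thesis
    using S by (simp add: borel_measurable_restrict_space_iff)
qed

text \<open>The target space need not be separable, so the norm is reached as a limit of the real
  functions \<open>norm (s n x)\<close>. Convergence may fail on a null set, which completeness
  absorbs.\<close>

lemma strongly_measurable_norm:
  fixes f :: "real \<Rightarrow> 'x::real_normed_vector"
  assumes f: "strongly_measurable (lebesgue_on S) f" and S: "S \<in> sets lebesgue"
  shows "(\<lambda>x. norm (f x)) \<in> borel_measurable (lebesgue_on S)"
proof -
  let ?M = "lebesgue_on S"
  obtain s where s: "\<And>n. simple_function ?M (s n)"
    and lim: "AE x in ?M. (\<lambda>n. s n x) \<longlonglongrightarrow> f x"
    using f unfolding strongly_measurable_def by blast
  obtain N where N: "N \<in> null_sets ?M"
    "\<And>x. x \<in> space ?M - N \<Longrightarrow> (\<lambda>n. s n x) \<longlonglongrightarrow> f x"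
    using AE_E3[OF lim] by blast
  \<comment> \<open>The indicator makes both sides 0 on the exceptional set, so convergence holds at
    every point, as the theorem on pointwise limits demands.\<close>
  have "(\<lambda>x. indicat_real (space ?M - N) x * norm (f x)) \<in> borel_measurable ?M"
  proof (rule borel_measurable_LIMSEQ_real)
    show "(\<lambda>n. indicat_real (space ?M - N) x * norm (s n x))
        \<longlonglongrightarrow> indicat_real (space ?M - N) x * norm (f x)" if "x \<in> space ?M" for x
      by (cases "x \<in> N") (use that N(2)[of x] in \<open>auto intro!: tendsto_norm\<close>)
    show "(\<lambda>x. indicat_real (space ?M - N) x * norm (s n x)) \<in> borel_measurable ?M" for n
      using N(1) borel_measurable_simple_function[OF simple_function_compose1[OF s, of norm n]]
      by (intro borel_measurable_times borel_measurable_indicator) auto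
  qed
  moreover have "AE x in ?M. indicat_real (space ?M - N) x * norm (f x) = norm (f x)"
    using AE_not_in[OF N(1)] AE_space by eventually_elim simp
  ultimately show ?thesis
    by (rule borel_measurable_lebesgue_on_AE[OF _ S])
qed

lemma strongly_measurable_add:
  fixes f g :: "'a \<Rightarrow> 'x::real_normed_vector"
  assumes f: "strongly_measurable M f" and g: "strongly_measurable M g"
  shows "strongly_measurable M (\<lambda>x. f x + g x)"
proof -
  obtain s s' where s: "\<And>n. simple_function M (s n)" "AE x in M. (\<lambda>n. s n x) \<longlonglongrightarrow> f x"
    and s': "\<And>n. simple_function M (s' n)" "AE x in M. (\<lambda>n. s' n x) \<longlonglongrightarrow> g x"
    using f g unfolding strongly_measurable_def by blast
  have "AE x in M. (\<lambda>n. s n x + s' n x) \<longlonglongrightarrow> f x + g x"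
    using s(2) s'(2) by eventually_elim (rule tendsto_add)
  moreover have "simple_function M (\<lambda>x. s n x + s' n x)" for n
    using s(1) s'(1) by (rule simple_function_compose2)
  ultimately show ?thesis
    unfolding strongly_measurable_def by (intro exI[of _ "\<lambda>n x. s n x + s' n x"]) blast
qed

lemma strongly_measurable_bounded_linear:
  assumes L: "bounded_linear L" and f: "strongly_measurable M f"
  shows "strongly_measurable M (\<lambda>x. L (f x))"
proof -
  obtain s where s: "\<And>n. simple_function M (s n)" "AE x in M. (\<lambda>n. s n x) \<longlonglongrightarrow> f x"
    using f unfolding strongly_measurable_def by blast
  have "AE x in M. (\<lambda>n. L (s n x)) \<longlonglongrightarrow> L (f x)"
    using s(2) by eventually_elim (rule bounded_linear.tendsto[OF L])
  moreover have "simple_function M (\<lambda>x. L (s n x))" for n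
    using s(1) by (rule simple_function_compose1)
  ultimately show ?thesis
    unfolding strongly_measurable_def by (intro exI[of _ "\<lambda>n x. L (s n x)"]) blast
qed

lemma L2_timeI:
  fixes v :: "real \<Rightarrow> 'x::real_normed_vector"
  assumes v: "strongly_measurable (time_measure T) v"
    and g: "integrable (time_measure T) g"
    and le: "AE t in time_measure T. (norm (v t))\<^sup>2 \<le> g t"
  shows "v \<in> L2_time T"
proof -
  have "(\<lambda>t. (norm (v t))\<^sup>2) \<in> borel_measurable (time_measure T)"
    using strongly_measurable_norm[OF v] by simp
  moreover have "AE t in time_measure T. norm ((norm (v t))\<^sup>2) \<le> norm (g t)"
    using le by eventually_elim simp
  ultimately have "integrable (time_measure T) (\<lambda>t. (norm (v t))\<^sup>2)"
    by (rule Bochner_Integration.integrable_bound[OF g])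
  then show ?thesis
    using v by (simp add: L2_time_def)
qed

lemma L2_time_integrable:
  "v \<in> L2_time T \<Longrightarrow> integrable (time_measure T) (\<lambda>t. (norm (v t))\<^sup>2)"
  by (simp add: L2_time_def)

lemma L2_time_norm_power2: "(L2_time_norm T v)\<^sup>2 = (LINT t|time_measure T. (norm (v t))\<^sup>2)"
  by (simp add: L2_time_norm_def)

lemma L2_time_zero: "(\<lambda>t. 0) \<in> L2_time T"
  by (auto simp: L2_time_def strongly_measurable_def intro!: exI[of _ "\<lambda>n x. 0"])

lemma L2_time_norm_zero: "L2_time_norm T (\<lambda>t. 0) = 0"
  by (simp add: L2_time_norm_def)

lemma L2_time_add:
  assumes "v \<in> L2_time T" "w \<in> L2_time T"
  shows "(\<lambda>t. v t + w t) \<in> L2_time T"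
proof (rule L2_timeI)
  show "strongly_measurable (time_measure T) (\<lambda>t. v t + w t)"
    using assms by (simp add: L2_time_def strongly_measurable_add)
  show "integrable (time_measure T) (\<lambda>t. 2 * (norm (v t))\<^sup>2 + 2 * (norm (w t))\<^sup>2)"
    using assms by (simp add: L2_time_def)
  have "(norm (v t + w t))\<^sup>2 \<le> 2 * (norm (v t))\<^sup>2 + 2 * (norm (w t))\<^sup>2" for t
  proof -
    have "(norm (v t + w t))\<^sup>2 \<le> (norm (v t) + norm (w t))\<^sup>2"
      by (intro power_mono norm_triangle_ineq norm_ge_zero)
    also have "\<dots> \<le> 2 * (norm (v t))\<^sup>2 + 2 * (norm (w t))\<^sup>2"
      using sum_squares_bound[of "norm (v t)" "norm (w t)"] by (simp add: power2_sum)
    finally show ?thesis .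
  qed
  then show "AE t in time_measure T. (norm (v t + w t))\<^sup>2 \<le> 2 * (norm (v t))\<^sup>2 + 2 * (norm (w t))\<^sup>2"
    by simp
qed

lemma L2_time_bounded_linear:
  assumes L: "bounded_linear L" and v: "v \<in> L2_time T"
  shows "(\<lambda>t. L (v t)) \<in> L2_time T"
proof -
  obtain K where K: "\<And>x. norm (L x) \<le> norm x * K"
    using bounded_linear.bounded[OF L] by blast
  show ?thesis
  proof (rule L2_timeI)
    show "strongly_measurable (time_measure T) (\<lambda>t. L (v t))"
      using v by (simp add: L2_time_def strongly_measurable_bounded_linear[OF L])
    show "integrable (time_measure T) (\<lambda>t. (norm (v t))\<^sup>2 * K\<^sup>2)"
      using v by (simp add: L2_time_def)
    have "(norm (L (v t)))\<^sup>2 \<le> (norm (v t))\<^sup>2 * K\<^sup>2" for t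
      unfolding power_mult_distrib[symmetric] by (intro power_mono K norm_ge_zero)
    then show "AE t in time_measure T. (norm (L (v t)))\<^sup>2 \<le> (norm (v t))\<^sup>2 * K\<^sup>2"
      by simp
  qed
qed

lemma L2_time_lincomb:
  assumes "\<And>k. k \<in> I \<Longrightarrow> v k \<in> L2_time T"
  shows "(\<lambda>t. \<Sum>k\<in>I. c k *\<^sub>R v k t) \<in> L2_time T"
  using assms
proof (induction I rule: infinite_finite_induct)
  case (insert k I)
  then show ?case
    by (auto intro!: L2_time_add L2_time_bounded_linear[OF bounded_linear_scaleR_right])
qed (simp_all add: L2_time_zero)

lemma L2_time_cong_AE:
  assumes v: "v \<in> L2_time T" and ae: "AE t in time_measure T. v t = v' t"
  shows "v' \<in> L2_time T"
proof (rule L2_timeI)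
  obtain s where s: "\<And>n. simple_function (time_measure T) (s n)"
    "AE x in time_measure T. (\<lambda>n. s n x) \<longlonglongrightarrow> v x"
    using v unfolding L2_time_def strongly_measurable_def by blast
  have "AE x in time_measure T. (\<lambda>n. s n x) \<longlonglongrightarrow> v' x"
    using s(2) ae by eventually_elim simp
  then show "strongly_measurable (time_measure T) v'"
    using s(1) unfolding strongly_measurable_def by blast
  show "integrable (time_measure T) (\<lambda>t. (norm (v t))\<^sup>2)"
    using v by (rule L2_time_integrable)
  show "AE t in time_measure T. (norm (v' t))\<^sup>2 \<le> (norm (v t))\<^sup>2"
    using ae by eventually_elim simp
qed

lemma L2_time_norm_cong_AE:
  assumes v: "v \<in> L2_time T" and ae: "AE t in time_measure T. v t = v' t"
  shows "L2_time_norm T v' = L2_time_norm T v"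
proof -
  have "(LINT t|time_measure T. (norm (v' t))\<^sup>2) = (LINT t|time_measure T. (norm (v t))\<^sup>2)"
    using L2_time_integrable[OF v] L2_time_integrable[OF L2_time_cong_AE[OF v ae]] ae
    by (intro integral_cong_AE) (auto elim: eventually_mono)
  then show ?thesis
    by (simp add: L2_time_norm_def)
qed

lemma L2_time_norm_scaleR: "L2_time_norm T (\<lambda>t. c *\<^sub>R v t) = \<bar>c\<bar> * L2_time_norm T v"
  by (simp add: L2_time_norm_def power_mult_distrib real_sqrt_mult)

lemma L2_time_norm_eq_0D:
  assumes v: "v \<in> L2_time T" and "L2_time_norm T v = 0"
  shows "AE t in time_measure T. v t = 0"
proof -
  have "(LINT t|time_measure T. (norm (v t))\<^sup>2) = 0"
    using assms(2) by (simp add: L2_time_norm_def)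
  then have "AE t in time_measure T. (norm (v t))\<^sup>2 = 0"
    using L2_time_integrable[OF v] by (subst (asm) integral_nonneg_eq_0_iff_AE) auto
  then show ?thesis
    by eventually_elim simp
qed

text \<open>Triangle inequality and Cauchy-Schwarz at each time, then integration. Coefficients and
  norms stay in separate factors so that normalised coefficients can be inserted later.\<close>

lemma L2_time_norm_lincomb_le:
  fixes v :: "'i \<Rightarrow> real \<Rightarrow> 'x::real_normed_vector"
  assumes v: "\<And>k. k \<in> I \<Longrightarrow> v k \<in> L2_time T"
  shows "(L2_time_norm T (\<lambda>t. \<Sum>k\<in>I. c k *\<^sub>R v k t))\<^sup>2
    \<le> (\<Sum>k\<in>I. (c k)\<^sup>2) * (\<Sum>k\<in>I. (L2_time_norm T (v k))\<^sup>2)"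
proof -
  have "(norm (\<Sum>k\<in>I. c k *\<^sub>R v k t))\<^sup>2 \<le> (\<Sum>k\<in>I. (c k)\<^sup>2) * (\<Sum>k\<in>I. (norm (v k t))\<^sup>2)" for t
  proof -
    have "norm (\<Sum>k\<in>I. c k *\<^sub>R v k t) \<le> (\<Sum>k\<in>I. \<bar>c k\<bar> * norm (v k t))"
      by (rule order_trans[OF norm_sum]) simp
    then have "(norm (\<Sum>k\<in>I. c k *\<^sub>R v k t))\<^sup>2 \<le> (\<Sum>k\<in>I. \<bar>c k\<bar> * norm (v k t))\<^sup>2"
      by (rule power_mono) simp
    also have "\<dots> \<le> (\<Sum>k\<in>I. \<bar>c k\<bar>\<^sup>2) * (\<Sum>k\<in>I. (norm (v k t))\<^sup>2)"
      by (rule Cauchy_Schwarz_ineq_sum)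
    finally show ?thesis by simp
  qed
  then have "(LINT t|time_measure T. (norm (\<Sum>k\<in>I. c k *\<^sub>R v k t))\<^sup>2)
      \<le> (LINT t|time_measure T. (\<Sum>k\<in>I. (c k)\<^sup>2) * (\<Sum>k\<in>I. (norm (v k t))\<^sup>2))"
    using L2_time_integrable[OF L2_time_lincomb[of I v, OF v]] L2_time_integrable[OF v]
    by (intro integral_mono) auto
  also have "\<dots> = (\<Sum>k\<in>I. (c k)\<^sup>2) * (\<Sum>k\<in>I. LINT t|time_measure T. (norm (v k t))\<^sup>2)"
    using L2_time_integrable[OF v] by simp
  finally show ?thesis
    by (simp add: L2_time_norm_power2)
qed


section \<open>Linear evolution equations\<close>

text \<open>Bridge from almost-everywhere statements on the open interval to gauge integrals over
  \<open>{0..t}\<close>, which tolerate changes on negligible sets. The endpoints 0 and T join the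
  exceptional set, since the open interval says nothing about them.\<close>

lemma AE_time_measure_negligible:
  assumes "AE t in time_measure T. P t"
  obtains N where "negligible N" "\<And>t. t \<in> {0..T} - N \<Longrightarrow> P t"
proof -
  have "AE t in lebesgue. t \<in> {0<..<T} \<longrightarrow> P t"
    using assms by (subst (asm) AE_restrict_space_iff) auto
  then obtain N where N: "N \<in> null_sets lebesgue" "\<And>t. t \<notin> N \<Longrightarrow> t \<in> {0<..<T} \<longrightarrow> P t"
    unfolding completion.AE_iff_null_sets by auto
  show thesis
  proof (rule that[of "N \<union> {0, T}"])
    show "negligible (N \<union> {0, T})"
      using N(1) by (auto simp: negligible_iff_null_sets[symmetric])
    show "P t" if "t \<in> {0..T} - (N \<union> {0, T})" for t
      using that N(2)[of t] by auto
  qed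
qed

lemma AE_time_measureI: "(\<And>t. t \<in> {0..T} \<Longrightarrow> P t) \<Longrightarrow> AE t in time_measure T. P t"
  by (rule AE_I2) (simp add: space_restrict_space)

text \<open>Collects what the linear theory takes from the normal triple and assumption (A).
  \<open>zero_data\<close> is the a priori estimate for vanishing initial value and source, the form
  in which it yields uniqueness.\<close>

locale evolution_equation =
  fixes e :: "'v::real_normed_vector \<Rightarrow> 'w::real_normed_vector" and T :: real and A :: "'v \<Rightarrow> 'w"
  assumes linear_e: "linear e" and inj_e: "inj e" and linear_A: "bounded_linear A"
    and solvable: "F \<in> L2_time T \<Longrightarrow> \<exists>w. evol_solution e T A 0 F w"
    and zero_data: "evol_solution e T A 0 (\<lambda>s. 0) w \<Longrightarrow> calV_norm e T w = 0"
begin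

section \<open>Calculus of V'-valued paths that lie in V almost everywhere\<close>

lemma toV_eqI: "w t = e x \<Longrightarrow> toV e w t = x"
  by (simp add: toV_def inj_e)

text \<open>Any square-integrable V-valued representative \<open>v\<close> settles membership and
  norm at once, because injectivity of \<open>e\<close> forces \<open>toV e w\<close> to agree with
  \<open>v\<close> almost everywhere.\<close>

lemma calVI:
  assumes v: "v \<in> L2_time T" and w: "AE t in time_measure T. w t = e (v t)"
  shows "w \<in> calV e T" "calV_norm e T w = L2_time_norm T v"
proof -
  have ae: "AE t in time_measure T. v t = toV e w t"
    using w by eventually_elim (simp add: toV_eqI)
  have "AE t in time_measure T. w t \<in> range e"
    using w by eventually_elim simp
  then show "w \<in> calV e T"
    using L2_time_cong_AE[OF v ae] by (simp add: calV_def)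
  show "calV_norm e T w = L2_time_norm T v"
    unfolding calV_norm_def by (rule L2_time_norm_cong_AE[OF v ae])
qed

lemma toV_L2: "w \<in> calV e T \<Longrightarrow> toV e w \<in> L2_time T"
  by (simp add: calV_def)

lemma toV_AE:
  assumes "w \<in> calV e T"
  shows "AE t in time_measure T. w t = e (toV e w t)"
proof -
  have "AE t in time_measure T. w t \<in> range e"
    using assms by (simp add: calV_def)
  then show ?thesis
    by eventually_elim (auto simp: toV_eqI)
qed

lemma calV_lincomb_AE:
  assumes "finite I" and w: "\<And>k. k \<in> I \<Longrightarrow> w k \<in> calV e T"
  shows "AE t in time_measure T. (\<Sum>k\<in>I. c k *\<^sub>R w k t) = e (\<Sum>k\<in>I. c k *\<^sub>R toV e (w k) t)"
proof -
  have "AE t in time_measure T. \<forall>k\<in>I. w k t = e (toV e (w k) t)"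
    using assms toV_AE by (auto simp: AE_finite_all)
  then show ?thesis
    by eventually_elim (simp add: linear_sum[OF linear_e] linear_scale[OF linear_e])
qed

lemma toV_lincomb_AE:
  assumes "finite I" and w: "\<And>k. k \<in> I \<Longrightarrow> w k \<in> calV e T"
  shows "AE t in time_measure T. toV e (\<lambda>t. \<Sum>k\<in>I. c k *\<^sub>R w k t) t = (\<Sum>k\<in>I. c k *\<^sub>R toV e (w k) t)"
proof -
  have "AE t in time_measure T. (\<Sum>k\<in>I. c k *\<^sub>R w k t) = e (\<Sum>k\<in>I. c k *\<^sub>R toV e (w k) t)"
    using assms by (rule calV_lincomb_AE)
  then show ?thesis
    by eventually_elim (simp add: toV_eqI)
qed

lemma
  assumes "finite I" and w: "\<And>k. k \<in> I \<Longrightarrow> w k \<in> calV e T"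
  shows calV_lincomb: "(\<lambda>t. \<Sum>k\<in>I. c k *\<^sub>R w k t) \<in> calV e T"
    and calV_norm_lincomb_le: "(calV_norm e T (\<lambda>t. \<Sum>k\<in>I. c k *\<^sub>R w k t))\<^sup>2
      \<le> (\<Sum>k\<in>I. (c k)\<^sup>2) * (\<Sum>k\<in>I. (calV_norm e T (w k))\<^sup>2)"
proof -
  have v: "(\<lambda>t. \<Sum>k\<in>I. c k *\<^sub>R toV e (w k) t) \<in> L2_time T"
    using w by (intro L2_time_lincomb toV_L2)
  have "AE t in time_measure T. (\<Sum>k\<in>I. c k *\<^sub>R w k t) = e (\<Sum>k\<in>I. c k *\<^sub>R toV e (w k) t)"
    using assms by (rule calV_lincomb_AE)
  note * = calVI[OF v this]
  show "(\<lambda>t. \<Sum>k\<in>I. c k *\<^sub>R w k t) \<in> calV e T"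
    by (rule *)
  show "(calV_norm e T (\<lambda>t. \<Sum>k\<in>I. c k *\<^sub>R w k t))\<^sup>2
      \<le> (\<Sum>k\<in>I. (c k)\<^sup>2) * (\<Sum>k\<in>I. (calV_norm e T (w k))\<^sup>2)"
    unfolding *(2) unfolding calV_norm_def using w by (intro L2_time_norm_lincomb_le toV_L2)
qed

lemma toV_scaleR_AE:
  assumes "w \<in> calV e T"
  shows "AE t in time_measure T. toV e (\<lambda>t. c *\<^sub>R w t) t = c *\<^sub>R toV e w t"
  using toV_lincomb_AE[of "{()}" "\<lambda>_. w" "\<lambda>_. c"] assms by simp

lemma toV_zero: "toV e (\<lambda>t. 0) = (\<lambda>t. 0)"
  by (rule ext, rule toV_eqI) (simp add: linear_0[OF linear_e])

lemma
  assumes "w \<in> calV e T"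
  shows calV_scaleR: "(\<lambda>t. c *\<^sub>R w t) \<in> calV e T"
    and calV_norm_scaleR: "calV_norm e T (\<lambda>t. c *\<^sub>R w t) = \<bar>c\<bar> * calV_norm e T w"
proof -
  have v: "(\<lambda>t. c *\<^sub>R toV e w t) \<in> L2_time T"
    using assms by (intro L2_time_bounded_linear[OF bounded_linear_scaleR_right] toV_L2)
  have "AE t in time_measure T. c *\<^sub>R w t = e (c *\<^sub>R toV e w t)"
    using toV_AE[OF assms] by eventually_elim (simp add: linear_scale[OF linear_e])
  from calVI[OF v this]
  show "(\<lambda>t. c *\<^sub>R w t) \<in> calV e T" "calV_norm e T (\<lambda>t. c *\<^sub>R w t) = \<bar>c\<bar> * calV_norm e T w"
    by (simp_all add: L2_time_norm_scaleR calV_norm_def)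
qed

lemma calV_zero: "(\<lambda>t. 0) \<in> calV e T"
  and calV_norm_zero: "calV_norm e T (\<lambda>t. 0) = 0"
  using calVI[OF L2_time_zero, of "\<lambda>t. 0"] by (simp_all add: linear_0[OF linear_e] L2_time_norm_zero)

lemma
  assumes w: "w \<in> calV e T" and eq: "\<And>t. t \<in> {0..T} \<Longrightarrow> w' t = w t"
  shows calV_cong: "w' \<in> calV e T" and calV_norm_cong: "calV_norm e T w' = calV_norm e T w"
proof -
  have "AE t in time_measure T. w' t = w t"
    using eq by (rule AE_time_measureI)
  then have "AE t in time_measure T. w' t = e (toV e w t)"
    using toV_AE[OF w] by eventually_elim simp
  from calVI[OF toV_L2[OF w] this]
  show "w' \<in> calV e T" "calV_norm e T w' = calV_norm e T w"
    by (simp_all add: calV_norm_def)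
qed

text \<open>The source enters only under an integral, which ignores null sets, and the path is
  tested only at times in [0,T]. Hence paths may be redefined freely outside [0,T].\<close>

lemma evol_solution_cong_AE:
  assumes sol: "evol_solution e T A g F w"
    and F: "AE s in time_measure T. F s = F' s"
    and eq: "\<And>t. t \<in> {0..T} \<Longrightarrow> w' t = w t"
  shows "evol_solution e T A g F' w'"
  unfolding evol_solution_def
proof (intro conjI ballI)
  show "w' \<in> calV e T"
    using sol eq by (auto simp: evol_solution_def intro: calV_cong)
  obtain N where N: "negligible N" "\<And>s. s \<in> {0..T} - N \<Longrightarrow> F s = F' s"
    using AE_time_measure_negligible[OF F] by blast
  fix t assume t: "t \<in> {0..T}"
  have "((\<lambda>s. A (toV e w s) + F s) has_integral (w t - g)) {0..t}"
    using sol t by (simp add: evol_solution_def)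
  then have "((\<lambda>s. A (toV e w' s) + F' s) has_integral (w t - g)) {0..t}"
    using t by (rule_tac has_integral_spike[OF N(1)]) (auto simp: N(2) toV_def eq)
  then show "((\<lambda>s. A (toV e w' s) + F' s) has_integral (w' t - g)) {0..t}"
    using t by (simp add: eq)
qed

text \<open>Superposition: \<open>A\<close> and the integral are linear, but \<open>toV\<close> is
  known to respect linear combinations only almost everywhere, so the integrand is exchanged off a
  negligible set.\<close>

lemma evol_solution_lincomb:
  assumes I: "finite I" and sol: "\<And>k. k \<in> I \<Longrightarrow> evol_solution e T A (g k) (F k) (w k)"
  shows "evol_solution e T A (\<Sum>k\<in>I. c k *\<^sub>R g k) (\<lambda>s. \<Sum>k\<in>I. c k *\<^sub>R F k s) (\<lambda>t. \<Sum>k\<in>I. c k *\<^sub>R w k t)"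
  unfolding evol_solution_def
proof (intro conjI ballI)
  have w: "w k \<in> calV e T" if "k \<in> I" for k
    using sol[OF that] by (simp add: evol_solution_def)
  show "(\<lambda>t. \<Sum>k\<in>I. c k *\<^sub>R w k t) \<in> calV e T"
    using I w by (rule calV_lincomb)
  obtain N where N: "negligible N" "\<And>s. s \<in> {0..T} - N \<Longrightarrow>
      toV e (\<lambda>t. \<Sum>k\<in>I. c k *\<^sub>R w k t) s = (\<Sum>k\<in>I. c k *\<^sub>R toV e (w k) s)"
    using AE_time_measure_negligible[OF toV_lincomb_AE[of I w c, OF I w]] by blast
  fix t assume t: "t \<in> {0..T}"
  interpret A: bounded_linear A by (rule linear_A)
  have "((\<lambda>s. \<Sum>k\<in>I. c k *\<^sub>R (A (toV e (w k) s) + F k s)) has_integral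
      (\<Sum>k\<in>I. c k *\<^sub>R (w k t - g k))) {0..t}"
    using sol t by (intro has_integral_sum[OF I] has_integral_cmul) (auto simp: evol_solution_def)
  then have "((\<lambda>s. A (toV e (\<lambda>t. \<Sum>k\<in>I. c k *\<^sub>R w k t) s) + (\<Sum>k\<in>I. c k *\<^sub>R F k s)) has_integral
      (\<Sum>k\<in>I. c k *\<^sub>R (w k t - g k))) {0..t}"
    using t by (rule_tac has_integral_spike[OF N(1)])
      (auto simp: N(2) A.sum A.scaleR scaleR_add_right sum.distrib)
  then show "((\<lambda>s. A (toV e (\<lambda>t. \<Sum>k\<in>I. c k *\<^sub>R w k t) s) + (\<Sum>k\<in>I. c k *\<^sub>R F k s)) has_integral
      ((\<Sum>k\<in>I. c k *\<^sub>R w k t) - (\<Sum>k\<in>I. c k *\<^sub>R g k))) {0..t}"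
    by (simp add: scaleR_diff_right sum_subtractf)
qed

text \<open>The difference \<open>d\<close> solves the equation with zero data, so its norm vanishes
  and \<open>toV e d\<close> is 0 almost everywhere. The integral identity for \<open>d\<close> then
  upgrades this to \<open>d t = 0\<close> at every time.\<close>

lemma evol_solution_unique:
  assumes w: "evol_solution e T A g F w" and w': "evol_solution e T A g F w'" and t: "t \<in> {0..T}"
  shows "w t = w' t"
proof -
  interpret A: bounded_linear A by (rule linear_A)
  define d where "d = (\<lambda>t. w t - w' t)"
  \<comment> \<open>The difference is the linear combination indexed by \<open>bool\<close> with
    coefficients 1 and -1.\<close>
  have d: "evol_solution e T A 0 (\<lambda>s. 0) d"
    using evol_solution_lincomb[of UNIV "\<lambda>_. g" "\<lambda>_. F" "\<lambda>b. if b then w else w'"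
        "\<lambda>b. if b then 1 else -1"] w w'
    by (simp add: UNIV_bool d_def)
  then have "AE s in time_measure T. toV e d s = 0"
    using zero_data[OF d] by (intro L2_time_norm_eq_0D toV_L2)
      (auto simp: calV_norm_def evol_solution_def)
  then obtain N where N: "negligible N" "\<And>s. s \<in> {0..T} - N \<Longrightarrow> toV e d s = 0"
    using AE_time_measure_negligible by blast
  have "((\<lambda>s. A (toV e d s) + 0) has_integral d t) {0..t}"
    using d t by (auto simp: evol_solution_def)
  moreover have "((\<lambda>s. A (toV e d s) + 0) has_integral 0) {0..t}"
    using t by (intro has_integral_spike[OF N(1) _ has_integral_0]) (auto simp: N(2))
  ultimately have "d t = 0"
    by (rule has_integral_unique)
  then show ?thesis by (simp add: d_def)
qed

text \<open>Uniqueness on [0,T] together with the value 0 elsewhere pins down a single function,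
  which justifies the definite description in \<open>duhamel\<close>.\<close>

lemma duhamel_eqI:
  assumes "evol_solution e T A g F w" and "\<And>t. t \<notin> {0..T} \<Longrightarrow> w t = 0"
  shows "duhamel e T A g F = w"
  unfolding duhamel_def
proof (rule the_equality)
  show "w' = w" if "evol_solution e T A g F w' \<and> (\<forall>t. t \<notin> {0..T} \<longrightarrow> w' t = 0)" for w'
  proof
    show "w' t = w t" for t
      using evol_solution_unique[of g F w' w t] assms that by (cases "t \<in> {0..T}") auto
  qed
qed (use assms in blast)

section \<open>Convolution with the semigroup as a linear operation on sources\<close>

lemma
  assumes "F \<in> L2_time T"
  shows Phi_conv_solution: "evol_solution e T A 0 F (Phi_conv e T A F)"
    and Phi_conv_outside: "t \<notin> {0..T} \<Longrightarrow> Phi_conv e T A F t = 0"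
proof -
  obtain w where w: "evol_solution e T A 0 F w"
    using solvable[OF assms] by blast
  define w' where "w' = (\<lambda>t. if t \<in> {0..T} then w t else 0)"
  have w': "evol_solution e T A 0 F w'"
    by (rule evol_solution_cong_AE[OF w]) (simp_all add: w'_def)
  then have "Phi_conv e T A F = w'"
    unfolding Phi_conv_def by (rule duhamel_eqI) (auto simp: w'_def)
  then show "evol_solution e T A 0 F (Phi_conv e T A F)"
    "t \<notin> {0..T} \<Longrightarrow> Phi_conv e T A F t = 0"
    using w' by (auto simp: w'_def)
qed

lemma Phi_conv_calV: "F \<in> L2_time T \<Longrightarrow> Phi_conv e T A F \<in> calV e T"
  using Phi_conv_solution by (simp add: evol_solution_def)

lemma Phi_conv_cong_AE:
  assumes F: "F \<in> L2_time T" and ae: "AE s in time_measure T. F s = F' s"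
  shows "Phi_conv e T A F' = Phi_conv e T A F"
  unfolding Phi_conv_def[of _ _ _ F']
  by (rule duhamel_eqI[OF evol_solution_cong_AE[OF Phi_conv_solution[OF F] ae]])
    (simp_all add: Phi_conv_outside[OF F])

text \<open>The right-hand side solves the combined equation and also vanishes outside [0,T]. The
  result is an equality of functions, available for rewriting inside further convolutions.\<close>

lemma Phi_conv_lincomb:
  assumes I: "finite I" and F: "\<And>k. k \<in> I \<Longrightarrow> F k \<in> L2_time T"
  shows "Phi_conv e T A (\<lambda>s. \<Sum>k\<in>I. c k *\<^sub>R F k s) = (\<lambda>t. \<Sum>k\<in>I. c k *\<^sub>R Phi_conv e T A (F k) t)"
  unfolding Phi_conv_def[of _ _ _ "\<lambda>s. \<Sum>k\<in>I. c k *\<^sub>R F k s"]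
proof (rule duhamel_eqI)
  show "evol_solution e T A 0 (\<lambda>s. \<Sum>k\<in>I. c k *\<^sub>R F k s) (\<lambda>t. \<Sum>k\<in>I. c k *\<^sub>R Phi_conv e T A (F k) t)"
    using evol_solution_lincomb[of I "\<lambda>_. 0" F "\<lambda>k. Phi_conv e T A (F k)" c, OF I Phi_conv_solution[OF F]] by simp
qed (simp add: Phi_conv_outside[OF F])

lemma Phi_conv_scaleR:
  "F \<in> L2_time T \<Longrightarrow> Phi_conv e T A (\<lambda>s. c *\<^sub>R F s) = (\<lambda>t. c *\<^sub>R Phi_conv e T A F t)"
  using Phi_conv_lincomb[of "{()}" "\<lambda>_. F" "\<lambda>_. c"] by simp

lemma Phi_conv_zero: "Phi_conv e T A (\<lambda>s. 0) = (\<lambda>t. 0)"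
  using Phi_conv_lincomb[of "{} :: nat set"] by simp

end


section \<open>Multi-indices\<close>

text \<open>Subtraction of multi-indices is truncated at 0, so \<open>meps k\<close> can be restored
  only for \<open>k\<close> in the support.\<close>

lemma meps_diff_add:
  fixes \<alpha> :: midx
  assumes "k \<in> Poly_Mapping.keys \<alpha>"
  shows "\<alpha> - meps k + meps k = \<alpha>"
  using assms
  by (intro poly_mapping_eqI) (auto simp: lookup_add lookup_minus lookup_single when_def in_keys_iff)

lemma mabs_add: "mabs (\<alpha> + \<beta>) = mabs \<alpha> + mabs \<beta>"
  unfolding mabs_def by (rule setsum_keys_plus_distrib) simp_all

lemma mabs_diff_meps: "k \<in> Poly_Mapping.keys \<alpha> \<Longrightarrow> Suc (mabs (\<alpha> - meps k)) = mabs \<alpha>"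
  by (subst (2) meps_diff_add[symmetric]) (simp_all add: mabs_add, simp add: mabs_def)

lemma mabs_eq_0_iff: "mabs \<alpha> = 0 \<longleftrightarrow> \<alpha> = 0"
  by (auto simp: mabs_def in_keys_iff intro: poly_mapping_eqI)

lemma mabs_zero: "mabs 0 = 0"
  by (simp add: mabs_eq_0_iff)

text \<open>Common source of the recursions for \<open>mpow\<close> and \<open>mfact\<close>.
  Lowering the multi-index at \<open>k\<close> alters one factor; if \<open>k\<close> thereby leaves
  the support, \<open>h j 0 = 1\<close> makes the lost factor neutral.\<close>

lemma prod_keys_diff_meps:
  fixes h :: "nat \<Rightarrow> nat \<Rightarrow> 'a::field" and \<alpha> :: midx
  assumes k: "k \<in> Poly_Mapping.keys \<alpha>" and h0: "\<And>j. h j 0 = 1"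
    and hk: "h k (Poly_Mapping.lookup \<alpha> k) = c * h k (Poly_Mapping.lookup \<alpha> k - 1)"
  shows "(\<Prod>j\<in>Poly_Mapping.keys \<alpha>. h j (Poly_Mapping.lookup \<alpha> j))
    = c * (\<Prod>j\<in>Poly_Mapping.keys (\<alpha> - meps k). h j (Poly_Mapping.lookup (\<alpha> - meps k) j))"
proof -
  have lk: "Poly_Mapping.lookup (\<alpha> - meps k) j = (if j = k then Poly_Mapping.lookup \<alpha> k - 1 else Poly_Mapping.lookup \<alpha> j)" for j
    by (simp add: lookup_minus lookup_single when_def)
  have "(\<Prod>j\<in>Poly_Mapping.keys (\<alpha> - meps k). h j (Poly_Mapping.lookup (\<alpha> - meps k) j))
      = (\<Prod>j\<in>Poly_Mapping.keys \<alpha>. h j (Poly_Mapping.lookup (\<alpha> - meps k) j))"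
    by (rule prod.mono_neutral_left) (auto simp: in_keys_iff lk h0 simp del: One_nat_def split: if_splits)
  also have "\<dots> = h k (Poly_Mapping.lookup \<alpha> k - 1)
      * (\<Prod>j\<in>Poly_Mapping.keys \<alpha> - {k}. h j (Poly_Mapping.lookup \<alpha> j))"
    using k by (simp add: prod.remove lk del: One_nat_def)
  finally show ?thesis
    using k hk by (simp add: prod.remove mult.assoc)
qed

lemma lookup_keys_pos: "k \<in> Poly_Mapping.keys (\<alpha> :: midx) \<Longrightarrow> 0 < Poly_Mapping.lookup \<alpha> k"
  by (simp add: in_keys_iff)

lemma mpow_diff_meps:
  assumes k: "k \<in> Poly_Mapping.keys \<alpha>"
  shows "mpow q \<alpha> = q k * mpow q (\<alpha> - meps k)"
  unfolding mpow_def using k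
  by (rule prod_keys_diff_meps) (use lookup_keys_pos[OF k] in \<open>auto simp: power_eq_if\<close>)

lemma mfact_diff_meps:
  assumes k: "k \<in> Poly_Mapping.keys \<alpha>"
  shows "mfact \<alpha> = real (Poly_Mapping.lookup \<alpha> k) * mfact (\<alpha> - meps k)"
  unfolding mfact_def using k
  by (rule prod_keys_diff_meps) (use lookup_keys_pos[OF k] in \<open>auto simp: fact_reduce\<close>)

lemma mpow_zero: "mpow q 0 = 1" and mfact_zero: "mfact 0 = 1"
  by (simp_all add: mpow_def mfact_def)

lemma mfact_pos: "0 < mfact \<alpha>"
  unfolding mfact_def by (rule prod_pos) simp

section \<open>Characteristic sets as multisets of indices, and their rearrangements\<close>

lemma count_mset_charset: "count (mset (charset \<alpha>)) k = Poly_Mapping.lookup \<alpha> k"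
proof -
  have "count (mset (concat (map (\<lambda>k. replicate (f k) k) xs))) k = (if k \<in> set xs then f k else 0)"
    if "distinct xs" for xs and f :: "nat \<Rightarrow> nat"
    using that by (induction xs) auto
  then show ?thesis
    by (simp add: charset_def in_keys_iff)
qed

lemma set_charset: "set (charset \<alpha>) = Poly_Mapping.keys \<alpha>"
  by (simp add: set_eq_iff in_keys_iff flip: count_mset_charset)

lemma length_charset: "length (charset \<alpha>) = mabs \<alpha>"
  unfolding size_mset[symmetric] size_multiset_overloaded_eq
  by (simp add: count_mset_charset set_charset mabs_def)

lemma mset_charset_diff_meps: "mset (charset (\<alpha> - meps k)) = mset (charset \<alpha>) - {#k#}"
  by (rule multiset_eqI) (simp add: count_mset_charset lookup_minus lookup_single when_def)

text \<open>Rearrangements are classified by their last entry, because the last index is the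
  outermost operator in \<open>iter_int\<close>. The recursion for
  \<open>permutations_of_multiset\<close> splits off the first entry, so the lists are reversed
  before and after.\<close>

lemma sum_permutations_of_multiset_snoc:
  fixes g :: "'a list \<Rightarrow> 'x::comm_monoid_add"
  assumes "B \<noteq> {#}"
  shows "(\<Sum>ys\<in>permutations_of_multiset B. g ys)
    = (\<Sum>k\<in>set_mset B. \<Sum>ys\<in>permutations_of_multiset (B - {#k#}). g (ys @ [k]))"
proof -
  have rev: "(\<Sum>ys\<in>permutations_of_multiset D. h ys) = (\<Sum>ys\<in>permutations_of_multiset D. h (rev ys))"
    for D and h :: "'a list \<Rightarrow> 'x"
    by (subst (1) rev_permutations_of_multiset[symmetric], subst sum.reindex) (auto simp: o_def)
  have "(\<Sum>ys\<in>permutations_of_multiset B. g ys)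
      = (\<Sum>ys\<in>(\<Union>k\<in>set_mset B. (#) k ` permutations_of_multiset (B - {#k#})). g (rev ys))"
    by (subst rev) (simp only: permutations_of_multiset_nonempty[OF assms])
  also have "\<dots> = (\<Sum>k\<in>set_mset B. \<Sum>ys\<in>(#) k ` permutations_of_multiset (B - {#k#}). g (rev ys))"
    by (subst sum.UNION_disjoint) auto
  also have "\<dots> = (\<Sum>k\<in>set_mset B. \<Sum>ys\<in>permutations_of_multiset (B - {#k#}). g (rev ys @ [k]))"
    by (simp add: sum.reindex)
  also have "\<dots> = (\<Sum>k\<in>set_mset B. \<Sum>ys\<in>permutations_of_multiset (B - {#k#}). g (ys @ [k]))"
    by (subst (2) rev) simp
  finally show ?thesis .
qed

text \<open>Orbit-stabiliser count: all fibres of \<sigma> \<mapsto>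
  \<open>permute_list \<sigma> xs\<close> over the rearrangements of \<open>xs\<close> have equal
  size, so each has n! elements divided by the number of rearrangements.\<close>

lemma card_permute_list_fibre:
  assumes "ys \<in> permutations_of_multiset (mset xs)"
  shows "card {\<sigma>. \<sigma> permutes {..<length xs} \<and> permute_list \<sigma> xs = ys}
    = (\<Prod>x\<in>set xs. fact (count (mset xs) x))"
proof -
  let ?P = "{\<sigma>. \<sigma> permutes {..<length xs}}"
  let ?fib = "\<lambda>ys. {\<sigma>\<in>?P. permute_list \<sigma> xs = ys}"
  have fib: "card (?fib zs) = card (?fib xs)" if zs: "zs \<in> permutations_of_multiset (mset xs)" for zs
  proof -
    obtain \<tau> where \<tau>: "\<tau> permutes {..<length xs}" "permute_list \<tau> xs = zs"
      using mset_eq_permutation[OF permutations_of_multisetD[OF zs]] by blast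
    \<comment> \<open>A stabiliser \<sigma> of \<open>xs\<close> composed with the fixed \<tau>
      first gives \<open>xs\<close> and then \<open>zs\<close>, since
      \<open>permute_list (\<sigma> \<circ> \<tau>) xs\<close> permutes by \<sigma> and then by
      \<tau>.\<close>
    have "bij_betw (\<lambda>\<sigma>. \<sigma> \<circ> \<tau>) (?fib xs) (?fib zs)"
    proof (rule bij_betw_byWitness[where f' = "\<lambda>\<sigma>. \<sigma> \<circ> inv \<tau>"])
      show "\<forall>\<sigma>\<in>?fib xs. \<sigma> \<circ> \<tau> \<circ> inv \<tau> = \<sigma>" "\<forall>\<sigma>\<in>?fib zs. \<sigma> \<circ> inv \<tau> \<circ> \<tau> = \<sigma>"
        using \<tau>(1) by (simp_all add: o_assoc[symmetric] permutes_inv_o)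
      show "(\<lambda>\<sigma>. \<sigma> \<circ> \<tau>) ` ?fib xs \<subseteq> ?fib zs"
        using \<tau> by (auto simp: permutes_compose permute_list_compose)
      have "permute_list (inv \<tau>) zs = xs"
        unfolding \<tau>(2)[symmetric] using \<tau>(1)
        by (simp add: permute_list_compose[symmetric] permutes_inv permutes_inv_o)
      then show "(\<lambda>\<sigma>. \<sigma> \<circ> inv \<tau>) ` ?fib zs \<subseteq> ?fib xs"
        using \<tau>(1) by (auto simp: permutes_compose permute_list_compose permutes_inv)
    qed
    then show ?thesis
      by (rule bij_betw_same_card[symmetric])
  qed
  have "fact (length xs) = (\<Sum>\<sigma>\<in>?P. 1 :: nat)"
    by (simp add: card_permutations[OF refl])
  also have "\<dots> = (\<Sum>zs\<in>permutations_of_multiset (mset xs). \<Sum>\<sigma>\<in>?fib zs. 1)"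
    by (rule sum.group[symmetric]) (auto simp: finite_permutations intro!: permutations_of_multisetI)
  also have "\<dots> = card (permutations_of_multiset (mset xs)) * card (?fib xs)"
    using fib by simp
  finally have "card (permutations_of_multiset (mset xs)) * card (?fib xs)
      = card (permutations_of_multiset (mset xs)) * (\<Prod>x\<in>set xs. fact (count (mset xs) x))"
    using card_permutations_of_multiset_aux[of "mset xs"] by simp
  then show ?thesis
    using fib[OF assms] by (simp add: card_eq_0_iff)
qed

lemma sum_permute_list:
  fixes g :: "'a list \<Rightarrow> 'x::real_vector"
  shows "(\<Sum>\<sigma> | \<sigma> permutes {..<length xs}. g (permute_list \<sigma> xs))
    = (\<Prod>x\<in>set xs. fact (count (mset xs) x)) *\<^sub>R (\<Sum>ys\<in>permutations_of_multiset (mset xs). g ys)"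
proof -
  let ?P = "{\<sigma>. \<sigma> permutes {..<length xs}}"
  have "(\<Sum>\<sigma>\<in>?P. g (permute_list \<sigma> xs)) = (\<Sum>ys\<in>permutations_of_multiset (mset xs).
      \<Sum>\<sigma>\<in>{\<sigma>\<in>?P. permute_list \<sigma> xs = ys}. g (permute_list \<sigma> xs))"
    by (rule sum.group[symmetric]) (auto simp: finite_permutations intro!: permutations_of_multisetI)
  also have "\<dots> = (\<Sum>ys\<in>permutations_of_multiset (mset xs).
      (\<Prod>x\<in>set xs. fact (count (mset xs) x)) *\<^sub>R g ys)"
  proof (rule sum.cong[OF refl])
    fix ys assume ys: "ys \<in> permutations_of_multiset (mset xs)"
    have "(\<Sum>\<sigma>\<in>{\<sigma>\<in>?P. permute_list \<sigma> xs = ys}. g (permute_list \<sigma> xs))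
        = (\<Sum>\<sigma>\<in>{\<sigma>\<in>?P. permute_list \<sigma> xs = ys}. g ys)"
      by (rule sum.cong) auto
    also have "\<dots> = (\<Prod>x\<in>set xs. fact (count (mset xs) x)) *\<^sub>R g ys"
      using card_permute_list_fibre[OF ys] by (simp add: sum_constant_scaleR del: sum_constant)
    finally show "(\<Sum>\<sigma>\<in>{\<sigma>\<in>?P. permute_list \<sigma> xs = ys}. g (permute_list \<sigma> xs))
        = (\<Prod>x\<in>set xs. fact (count (mset xs) x)) *\<^sub>R g ys" .
  qed
  finally show ?thesis
    by (simp add: scaleR_sum_right)
qed

text \<open>Passes from the permutation sum of the formula for the coefficients to distinct
  rearrangements, over which the recursion for the coefficients unwinds without repetition.\<close>

lemma sum_charset_permutations:
  fixes g :: "nat list \<Rightarrow> 'x::real_vector"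
  shows "(\<Sum>\<sigma> | \<sigma> permutes {..<mabs \<alpha>}. g (map (\<lambda>m. charset \<alpha> ! \<sigma> m) [0..<mabs \<alpha>]))
    = mfact \<alpha> *\<^sub>R (\<Sum>ys\<in>permutations_of_multiset (mset (charset \<alpha>)). g ys)"
  using sum_permute_list[of g "charset \<alpha>"]
  by (simp add: permute_list_def length_charset set_charset count_mset_charset mfact_def)

section \<open>Geometric decay of sums over the levels |\<alpha>| = n\<close>

context
  fixes B :: "midx \<Rightarrow> real" and x :: "nat \<Rightarrow> real"
  assumes B_nonneg: "\<And>\<alpha>. 0 \<le> B \<alpha>" and x_nonneg: "\<And>k. 0 \<le> x k" and x_summable: "summable x"
    and B_le: "\<And>\<alpha>. \<alpha> \<noteq> 0 \<Longrightarrow> B \<alpha> \<le> (\<Sum>k\<in>Poly_Mapping.keys \<alpha>. x k * B (\<alpha> - meps k))"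
begin

text \<open>One application of \<open>B_le\<close> rewrites the sum as one over pairs (k, \<beta>)
  with \<beta> = \<alpha> - \<epsilon>_k one level lower. Since \<alpha> = \<beta> + \<epsilon>_k is
  recovered from the pair, no pair occurs twice, and each level costs one factor
  \<open>suminf x\<close>.\<close>

lemma sum_level_le:
  assumes "finite F" "\<And>\<alpha>. \<alpha> \<in> F \<Longrightarrow> mabs \<alpha> = n"
  shows "sum B F \<le> suminf x ^ n * B 0"
  using assms
proof (induction n arbitrary: F)
  case 0
  then have "F \<subseteq> {0}" by (auto simp: mabs_eq_0_iff)
  then have "sum B F \<le> sum B {0}"
    by (intro sum_mono2) (auto simp: B_nonneg)
  then show ?case by simp
next
  case (Suc n)
  define S where "S = Sigma F Poly_Mapping.keys"
  define p where "p = (\<lambda>(\<alpha>, k). (k, \<alpha> - meps k))"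
  define K where "K = fst ` p ` S"
  define G where "G = snd ` p ` S"
  have fin: "finite S" "finite K" "finite G"
    using Suc.prems by (auto simp: S_def K_def G_def)
  have G: "mabs \<beta> = n" if \<beta>: "\<beta> \<in> G" for \<beta>
  proof -
    obtain \<alpha> k where "\<alpha> \<in> F" "k \<in> Poly_Mapping.keys \<alpha>" "\<beta> = \<alpha> - meps k"
      using \<beta> unfolding G_def p_def S_def by auto
    then show ?thesis
      using mabs_diff_meps[of k \<alpha>] Suc.prems(2)[of \<alpha>] by simp
  qed
  have inj: "inj_on p S"
  proof (rule inj_on_inverseI[where g = "\<lambda>(k, \<beta>). (\<beta> + meps k, k)"])
    show "(\<lambda>(k, \<beta>). (\<beta> + meps k, k)) (p z) = z" if "z \<in> S" for z
      using that meps_diff_add by (auto simp: p_def S_def simp del: One_nat_def)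
  qed
  have "sum B F \<le> (\<Sum>\<alpha>\<in>F. \<Sum>k\<in>Poly_Mapping.keys \<alpha>. x k * B (\<alpha> - meps k))"
    using Suc.prems(2)[of 0] by (intro sum_mono B_le) (auto simp: mabs_zero)
  also have "\<dots> = (\<Sum>(k, \<beta>)\<in>p ` S. x k * B \<beta>)"
    using Suc.prems(1) by (simp add: sum.Sigma sum.reindex[OF inj] S_def[symmetric])
      (simp add: p_def case_prod_unfold)
  \<comment> \<open>Enlarging to the full grid adds only nonnegative terms and makes the double sum
    a product.\<close>
  also have "\<dots> \<le> (\<Sum>(k, \<beta>)\<in>K \<times> G. x k * B \<beta>)"
  proof (rule sum_mono2)
    show "finite (K \<times> G)"
      using fin by simp
    show "p ` S \<subseteq> K \<times> G"
      unfolding K_def G_def by (metis subset_fst_snd)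
  qed (auto simp: B_nonneg x_nonneg)
  also have "\<dots> = sum x K * sum B G"
    by (simp add: sum_product sum.cartesian_product)
  also have "\<dots> \<le> suminf x * (suminf x ^ n * B 0)"
    using fin G by (intro mult_mono sum_le_suminf Suc.IH)
      (auto simp: x_nonneg x_summable B_nonneg sum_nonneg suminf_nonneg)
  finally show ?case by (simp add: mult.assoc)
qed

text \<open>A finite set meets finitely many levels, so the level bounds add up to part of a
  geometric series starting at exponent m. The case m = 0 later gives summability, growing m the
  vanishing of the remainder.\<close>

lemma sum_tail_le:
  assumes lt1: "suminf x < 1" and F: "finite F" "\<And>\<alpha>. \<alpha> \<in> F \<Longrightarrow> m \<le> mabs \<alpha>"
  shows "sum B F \<le> suminf x ^ m / (1 - suminf x) * B 0"
proof -
  let ?\<rho> = "suminf x"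
  have \<rho>: "0 \<le> ?\<rho>"
    by (rule suminf_nonneg[OF x_summable x_nonneg])
  obtain N where "\<forall>n\<in>mabs ` F. n < N"
    using F(1) finite_nat_set_iff_bounded by blast
  then have N: "\<And>\<alpha>. \<alpha> \<in> F \<Longrightarrow> mabs \<alpha> < m + N"
    by (simp add: trans_less_add2)
  have "sum B F = (\<Sum>n\<in>{m..<m+N}. sum B {\<alpha>\<in>F. mabs \<alpha> = n})"
    using F N by (intro sum.group[symmetric]) auto
  also have "\<dots> \<le> (\<Sum>n\<in>{m..<m+N}. ?\<rho> ^ n * B 0)"
    using F by (intro sum_mono sum_level_le) auto
  also have "\<dots> = ?\<rho> ^ m * (\<Sum>n<N. ?\<rho> ^ n) * B 0"
    by (simp add: sum_distrib_right sum_distrib_left sum.atLeastLessThan_shift_0[of _ m] power_add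
        lessThan_atLeast0)
  also have "\<dots> \<le> ?\<rho> ^ m * suminf (\<lambda>n. ?\<rho> ^ n) * B 0"
    using \<rho> lt1 by (intro mult_right_mono mult_left_mono sum_le_suminf) (auto simp: B_nonneg)
  also have "suminf (\<lambda>n. ?\<rho> ^ n) = 1 / (1 - ?\<rho>)"
    using \<rho> lt1 by (simp add: suminf_geometric)
  finally show ?thesis by simp
qed

end


section \<open>The coefficients of the solution\<close>

text \<open>Isolates the triangular system: \<open>w 0\<close> may be any element of
  \<open>calV\<close>, and each other coefficient is produced by those one level below. The
  recursion is an equality of functions on the whole line.\<close>

locale chaos_coefficients = evolution_equation e T A
  for e :: "'v::real_normed_vector \<Rightarrow> 'w::real_normed_vector" and T A +
  fixes M :: "nat \<Rightarrow> 'v \<Rightarrow> 'w" and w :: "midx \<Rightarrow> real \<Rightarrow> 'w"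
  assumes linear_M: "\<And>k. bounded_linear (M k)" and w_calV: "\<And>\<alpha>. w \<alpha> \<in> calV e T"
    and w_rec: "\<And>\<alpha>. \<alpha> \<noteq> 0 \<Longrightarrow> w \<alpha> = Phi_conv e T A (\<lambda>s. delta M (\<lambda>\<beta>. toV e (w \<beta>) s) \<alpha>)"
begin

lemma M_toV_L2: "v \<in> calV e T \<Longrightarrow> (\<lambda>s. M k (toV e v s)) \<in> L2_time T"
  by (intro L2_time_bounded_linear[OF linear_M] toV_L2)

lemma delta_L2:
  "(\<And>\<beta>. v \<beta> \<in> calV e T) \<Longrightarrow> (\<lambda>s. delta M (\<lambda>\<beta>. toV e (v \<beta>) s) \<alpha>) \<in> L2_time T"
  unfolding delta_def by (intro L2_time_lincomb M_toV_L2) auto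

lemma w_expand:
  assumes "\<alpha> \<noteq> 0"
  shows "w \<alpha> = (\<lambda>t. \<Sum>k\<in>Poly_Mapping.keys \<alpha>. sqrt (real (Poly_Mapping.lookup \<alpha> k)) *\<^sub>R
    Phi_conv e T A (\<lambda>s. M k (toV e (w (\<alpha> - meps k)) s)) t)"
  unfolding w_rec[OF assms] delta_def by (rule Phi_conv_lincomb) (auto intro: M_toV_L2 w_calV)

text \<open>The map that one more index adds to an iterated integral is linear. As
  \<open>toV\<close> is additive almost everywhere, the source is first exchanged for the sum by
  \<open>Phi_conv_cong_AE\<close>.\<close>

lemma Phi_conv_M_lincomb:
  assumes I: "finite I" and v: "\<And>l. l \<in> I \<Longrightarrow> v l \<in> calV e T"
  shows "Phi_conv e T A (\<lambda>s. M k (toV e (\<lambda>t. \<Sum>l\<in>I. c l *\<^sub>R v l t) s))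
    = (\<lambda>t. \<Sum>l\<in>I. c l *\<^sub>R Phi_conv e T A (\<lambda>s. M k (toV e (v l) s)) t)"
proof -
  interpret Mk: bounded_linear "M k" by (rule linear_M)
  have "AE s in time_measure T. toV e (\<lambda>t. \<Sum>l\<in>I. c l *\<^sub>R v l t) s = (\<Sum>l\<in>I. c l *\<^sub>R toV e (v l) s)"
    using I v by (rule toV_lincomb_AE)
  then have "AE s in time_measure T. (\<Sum>l\<in>I. c l *\<^sub>R M k (toV e (v l) s))
      = M k (toV e (\<lambda>t. \<Sum>l\<in>I. c l *\<^sub>R v l t) s)"
    by eventually_elim (simp add: Mk.sum Mk.scaleR)
  then have "Phi_conv e T A (\<lambda>s. M k (toV e (\<lambda>t. \<Sum>l\<in>I. c l *\<^sub>R v l t) s))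
      = Phi_conv e T A (\<lambda>s. \<Sum>l\<in>I. c l *\<^sub>R M k (toV e (v l) s))"
    by (intro Phi_conv_cong_AE L2_time_lincomb M_toV_L2 v)
  also have "\<dots> = (\<lambda>t. \<Sum>l\<in>I. c l *\<^sub>R Phi_conv e T A (\<lambda>s. M k (toV e (v l) s)) t)"
    using I v by (intro Phi_conv_lincomb M_toV_L2)
  finally show ?thesis .
qed

lemma iter_int_snoc:
  "iter_int e T A M (ks @ [k]) v = Phi_conv e T A (\<lambda>s. M k (toV e (iter_int e T A M ks v) s))"
  by (simp add: iter_int_def)

lemma iter_int_calV: "v \<in> calV e T \<Longrightarrow> iter_int e T A M ks v \<in> calV e T"
proof (induction ks rule: rev_induct)
  case Nil
  then show ?case by (simp add: iter_int_def)
next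
  case (snoc k ks)
  then show ?case by (simp add: iter_int_snoc Phi_conv_calV M_toV_L2)
qed

text \<open>Induction on the level. By \<open>mfact_diff_meps\<close> the product of
  \<surd>\<alpha>_k and \<surd>(\<alpha>-\<epsilon>_k)! is \<surd>\<alpha>! for every k, so this
  factor comes out of the sum; what remains runs over all rearrangements, sorted by their last
  entry.\<close>

lemma w_eq_sum_iter_int:
  "w \<alpha> = (\<lambda>t. sqrt (mfact \<alpha>) *\<^sub>R
    (\<Sum>ys\<in>permutations_of_multiset (mset (charset \<alpha>)). iter_int e T A M ys (w 0) t))"
proof (induction "mabs \<alpha>" arbitrary: \<alpha>)
  case 0
  then have "\<alpha> = 0" by (simp add: mabs_eq_0_iff)
  then show ?case by (simp add: mfact_zero charset_def iter_int_def)
next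
  case (Suc n)
  have \<alpha>: "\<alpha> \<noteq> 0"
    using Suc.hyps(2) by (auto simp: mabs_zero)
  let ?P = "\<lambda>k. permutations_of_multiset (mset (charset \<alpha>) - {#k#})"
  have step: "Phi_conv e T A (\<lambda>s. M k (toV e (w (\<alpha> - meps k)) s))
      = (\<lambda>t. \<Sum>ys\<in>?P k. sqrt (mfact (\<alpha> - meps k)) *\<^sub>R iter_int e T A M (ys @ [k]) (w 0) t)"
    if k: "k \<in> Poly_Mapping.keys \<alpha>" for k
  proof -
    have "w (\<alpha> - meps k)
        = (\<lambda>t. \<Sum>ys\<in>?P k. sqrt (mfact (\<alpha> - meps k)) *\<^sub>R iter_int e T A M ys (w 0) t)"
      using Suc.hyps mabs_diff_meps[OF k]
      by (subst Suc.hyps(1)) (simp_all add: mset_charset_diff_meps scaleR_sum_right del: One_nat_def)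
    then show ?thesis
      by (simp add: Phi_conv_M_lincomb iter_int_calV w_calV iter_int_snoc)
  qed
  have "w \<alpha> t = sqrt (mfact \<alpha>) *\<^sub>R
    (\<Sum>ys\<in>permutations_of_multiset (mset (charset \<alpha>)). iter_int e T A M ys (w 0) t)" for t
  proof -
    have "w \<alpha> t = (\<Sum>k\<in>Poly_Mapping.keys \<alpha>. sqrt (real (Poly_Mapping.lookup \<alpha> k)) *\<^sub>R
        (\<Sum>ys\<in>?P k. sqrt (mfact (\<alpha> - meps k)) *\<^sub>R iter_int e T A M (ys @ [k]) (w 0) t))"
      by (subst w_expand[OF \<alpha>]) (simp add: step del: One_nat_def)
    also have "\<dots> = (\<Sum>k\<in>Poly_Mapping.keys \<alpha>. sqrt (mfact \<alpha>) *\<^sub>R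
        (\<Sum>ys\<in>?P k. iter_int e T A M (ys @ [k]) (w 0) t))"
      by (intro sum.cong refl) (simp add: mfact_diff_meps real_sqrt_mult del: One_nat_def flip: scaleR_sum_right)
    also have "\<dots> = sqrt (mfact \<alpha>) *\<^sub>R
        (\<Sum>ys\<in>permutations_of_multiset (mset (charset \<alpha>)). iter_int e T A M ys (w 0) t)"
      using Suc.hyps(2) length_charset[of \<alpha>]
      by (subst sum_permutations_of_multiset_snoc) (auto simp: set_charset scaleR_sum_right)
    finally show ?thesis .
  qed
  then show ?case by blast
qed

text \<open>Each application of the operator raises the level by one, so from level 0 the n-th
  iterate lives exactly on level n. There it repeats the recursion for \<open>w\<close>, and the
  factors q_k accumulate to q^\<alpha>.\<close>

lemma iter_delta_eq:
  "iter_delta e T A (\<lambda>k x. q k *\<^sub>R M k x) (w 0) n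
    = (\<lambda>\<alpha> t. if mabs \<alpha> = n then mpow q \<alpha> *\<^sub>R w \<alpha> t else 0)"
proof (induction n)
  case 0
  show ?case
    by (auto simp: iter_delta_def fun_eq_iff mabs_eq_0_iff mpow_zero)
next
  case (Suc n)
  let ?v = "\<lambda>\<beta> t. if mabs \<beta> = n then mpow q \<beta> *\<^sub>R w \<beta> t else 0"
  have "iter_delta e T A (\<lambda>k x. q k *\<^sub>R M k x) (w 0) (Suc n) \<alpha>
      = (\<lambda>t. if mabs \<alpha> = Suc n then mpow q \<alpha> *\<^sub>R w \<alpha> t else 0)" for \<alpha>
  proof -
    have eq: "iter_delta e T A (\<lambda>k x. q k *\<^sub>R M k x) (w 0) (Suc n) \<alpha>
        = Phi_conv e T A (\<lambda>s. delta (\<lambda>k x. q k *\<^sub>R M k x) (\<lambda>\<beta>. toV e (?v \<beta>) s) \<alpha>)"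
      using Suc by (simp add: iter_delta_def)
    show ?thesis
    proof (cases "mabs \<alpha> = Suc n")
      case True
      \<comment> \<open>The scalar leaves \<open>toV\<close> only almost everywhere; finiteness of
        the support then yields one null set for all k.\<close>
      have "AE s in time_measure T. toV e (?v (\<alpha> - meps k)) s
          = mpow q (\<alpha> - meps k) *\<^sub>R toV e (w (\<alpha> - meps k)) s" if "k \<in> Poly_Mapping.keys \<alpha>" for k
        using toV_scaleR_AE[OF w_calV] mabs_diff_meps[OF that] True by simp
      then have "AE s in time_measure T. \<forall>k\<in>Poly_Mapping.keys \<alpha>. toV e (?v (\<alpha> - meps k)) s
          = mpow q (\<alpha> - meps k) *\<^sub>R toV e (w (\<alpha> - meps k)) s"
        by (simp add: AE_finite_all)
      then have "AE s in time_measure T. mpow q \<alpha> *\<^sub>R delta M (\<lambda>\<beta>. toV e (w \<beta>) s) \<alpha>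
          = delta (\<lambda>k x. q k *\<^sub>R M k x) (\<lambda>\<beta>. toV e (?v \<beta>) s) \<alpha>"
        by eventually_elim (auto simp: delta_def scaleR_sum_right mpow_diff_meps
            linear_scale[OF bounded_linear.linear[OF linear_M]] mult_ac intro!: sum.cong)
      then have "iter_delta e T A (\<lambda>k x. q k *\<^sub>R M k x) (w 0) (Suc n) \<alpha>
          = Phi_conv e T A (\<lambda>s. mpow q \<alpha> *\<^sub>R delta M (\<lambda>\<beta>. toV e (w \<beta>) s) \<alpha>)"
        unfolding eq
        by (intro Phi_conv_cong_AE L2_time_bounded_linear[OF bounded_linear_scaleR_right] delta_L2 w_calV)
      also have "\<dots> = (\<lambda>t. mpow q \<alpha> *\<^sub>R w \<alpha> t)"
        using True by (subst (2) w_rec) (auto simp: mabs_zero Phi_conv_scaleR delta_L2 w_calV)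
      finally show ?thesis
        using True by simp
    next
      case False
      have "delta (\<lambda>k x. q k *\<^sub>R M k x) (\<lambda>\<beta>. toV e (?v \<beta>) s) \<alpha> = 0" for s
        unfolding delta_def
      proof (intro sum.neutral ballI)
        fix k assume "k \<in> Poly_Mapping.keys \<alpha>"
        then have "mabs (\<alpha> - meps k) \<noteq> n"
          using mabs_diff_meps False by auto
        then show "sqrt (real (Poly_Mapping.lookup \<alpha> k)) *\<^sub>R q k *\<^sub>R M k (toV e (?v (\<alpha> - meps k)) s) = 0"
          by (simp add: toV_zero linear_0[OF bounded_linear.linear[OF linear_M]])
      qed
      then show ?thesis
        using False by (simp add: eq Phi_conv_zero)
    qed
  qed
  then show ?case by blast
qed

text \<open>Cauchy--Schwarz with the weights \<open>\<alpha>\<^sub>k / |\<alpha>|\<close>, which sum to 1, makes the factorial in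
  \<open>r\<^sub>\<alpha>\<close> absorb the factors \<open>\<surd>\<alpha>\<^sub>k\<close>.\<close>

lemma weighted_norm_le:
  fixes q C :: "nat \<Rightarrow> real"
  assumes C: "\<And>k v. v \<in> L2_time T \<Longrightarrow>
      (calV_norm e T (Phi_conv e T A (\<lambda>s. M k (v s))))\<^sup>2 \<le> (C k)\<^sup>2 * (L2_time_norm T v)\<^sup>2"
    and \<alpha>: "\<alpha> \<noteq> 0"
  defines "B \<equiv> \<lambda>\<alpha>. (mpow q \<alpha> / sqrt (fact (mabs \<alpha>)))\<^sup>2 * (calV_norm e T (w \<alpha>))\<^sup>2"
  shows "B \<alpha> \<le> (\<Sum>k\<in>Poly_Mapping.keys \<alpha>. ((q k)\<^sup>2 * (C k)\<^sup>2) * B (\<alpha> - meps k))"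
proof -
  define n where "n = mabs \<alpha>"
  have n: "n > 0"
    using \<alpha> mabs_eq_0_iff[of \<alpha>] by (simp add: n_def)
  define y where "y = (\<lambda>k. Phi_conv e T A (\<lambda>s. M k (toV e (w (\<alpha> - meps k)) s)))"
  have y: "y k \<in> calV e T" for k
    unfolding y_def by (intro Phi_conv_calV M_toV_L2 w_calV)
  have yC: "(calV_norm e T (y k))\<^sup>2 \<le> (C k)\<^sup>2 * (calV_norm e T (w (\<alpha> - meps k)))\<^sup>2" for k
    using C[OF toV_L2[OF w_calV]] unfolding y_def calV_norm_def[of _ _ "w _"] .
  let ?c = "\<lambda>k. sqrt (real (Poly_Mapping.lookup \<alpha> k) / real n)"
  have "w \<alpha> = (\<lambda>t. \<Sum>k\<in>Poly_Mapping.keys \<alpha>. ?c k *\<^sub>R (sqrt n *\<^sub>R y k t))"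
    using n by (subst w_expand[OF \<alpha>]) (simp add: y_def real_sqrt_divide)
  then have "(calV_norm e T (w \<alpha>))\<^sup>2 \<le> (\<Sum>k\<in>Poly_Mapping.keys \<alpha>. (?c k)\<^sup>2)
      * (\<Sum>k\<in>Poly_Mapping.keys \<alpha>. (calV_norm e T (\<lambda>t. sqrt n *\<^sub>R y k t))\<^sup>2)"
    using calV_norm_lincomb_le[of "Poly_Mapping.keys \<alpha>" "\<lambda>k t. sqrt n *\<^sub>R y k t" ?c]
    by (simp add: calV_scaleR y)
  also have "(\<Sum>k\<in>Poly_Mapping.keys \<alpha>. (?c k)\<^sup>2) = 1"
  proof -
    have "(\<Sum>k\<in>Poly_Mapping.keys \<alpha>. real (Poly_Mapping.lookup \<alpha> k)) = n"
      by (simp add: n_def mabs_def)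
    then show ?thesis
      using n by (simp flip: sum_divide_distrib)
  qed
  finally have "(calV_norm e T (w \<alpha>))\<^sup>2
      \<le> (\<Sum>k\<in>Poly_Mapping.keys \<alpha>. n * (calV_norm e T (y k))\<^sup>2)"
    by (simp add: calV_norm_scaleR y power_mult_distrib)
  also have "\<dots> \<le> (\<Sum>k\<in>Poly_Mapping.keys \<alpha>. n * ((C k)\<^sup>2 * (calV_norm e T (w (\<alpha> - meps k)))\<^sup>2))"
    by (intro sum_mono mult_left_mono yC) simp
  finally have "B \<alpha> \<le> (mpow q \<alpha> / sqrt (fact n))\<^sup>2
      * (\<Sum>k\<in>Poly_Mapping.keys \<alpha>. n * ((C k)\<^sup>2 * (calV_norm e T (w (\<alpha> - meps k)))\<^sup>2))"
    unfolding B_def n_def[symmetric] by (rule mult_left_mono) simp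
  also have "\<dots> = (\<Sum>k\<in>Poly_Mapping.keys \<alpha>. ((q k)\<^sup>2 * (C k)\<^sup>2) * B (\<alpha> - meps k))"
    unfolding sum_distrib_left
  proof (rule sum.cong[OF refl])
    fix k assume k: "k \<in> Poly_Mapping.keys \<alpha>"
    then have "n = Suc (mabs (\<alpha> - meps k))"
      by (simp add: n_def mabs_diff_meps del: One_nat_def)
    \<comment> \<open>The factor \<open>n\<close> left by the normalised weights turns 1/n! into
      1/(n-1)!, the factorial belonging to \<alpha> - \<epsilon>_k, while q^\<alpha> releases one
      factor q_k.\<close>
    then have "(mpow q \<alpha> / sqrt (fact n))\<^sup>2 * n
        = (q k)\<^sup>2 * (mpow q (\<alpha> - meps k) / sqrt (fact (mabs (\<alpha> - meps k))))\<^sup>2"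
      using k by (simp add: mpow_diff_meps[of k] power_divide power_mult_distrib divide_simps)
    then show "(mpow q \<alpha> / sqrt (fact n))\<^sup>2 * (n * ((C k)\<^sup>2 * (calV_norm e T (w (\<alpha> - meps k)))\<^sup>2))
        = (q k)\<^sup>2 * (C k)\<^sup>2 * B (\<alpha> - meps k)"
      by (simp add: B_def mult_ac)
  qed
  finally show ?thesis .
qed

end


section \<open>Wiener chaos solution of the evolution equation\<close>

theorem theorem11:
  fixes P :: "'o measure"
    and W :: "'u::{real_inner, complete_space} \<Rightarrow> 'o \<Rightarrow> real"
    and b :: "nat \<Rightarrow> 'u"
    and \<xi> :: "midx \<Rightarrow> 'o \<Rightarrow> real"
    and i :: "'v::{real_inner, complete_space} \<Rightarrow> 'h::{real_inner, complete_space}"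
    and j :: "'h \<Rightarrow> 'w::{real_inner, complete_space}"
    and e :: "'v \<Rightarrow> 'w"
    and T :: real
    and A :: "'v \<Rightarrow> 'w"
    and M :: "nat \<Rightarrow> 'v \<Rightarrow> 'w"
    and C :: "nat \<Rightarrow> real"
    and u0 :: 'h
    and f :: "real \<Rightarrow> 'w"
    and u :: "midx \<Rightarrow> real \<Rightarrow> 'h"
    and u00 :: "real \<Rightarrow> 'w"
  assumes noise: "gaussian_noise P W" "orthonormal_basis b"
    and xi: "\<xi> = xi W b"
    and triple: "normal_triple i j"
    and e: "e = j \<circ> i"
    and T: "T > 0"
    and A: "bounded_linear A" "assumption_A i j T A"
    and M: "\<And>k. bounded_linear (M k)"
    and C: "\<And>k v. v \<in> L2_time T \<Longrightarrow>
      (calV_norm e T (Phi_conv e T A (\<lambda>s. M k (v s))))\<^sup>2 \<le> (C k)\<^sup>2 * (L2_time_norm T v)\<^sup>2"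
    and f: "f \<in> L2_time T"
    and u: "spde_solution i j T A M u0 f u"
    and u00: "u00 = duhamel e T A (j u0) f"
  shows
    "(\<forall>\<alpha> n. mabs \<alpha> = n \<and> n \<ge> 1 \<longrightarrow> (\<forall>t\<in>{0..T}.
        j (u \<alpha> t) = (1 / sqrt (mfact \<alpha>)) *\<^sub>R
          (\<Sum>\<sigma>\<in>{\<sigma>. \<sigma> permutes {..<n}}.
             iter_int e T A M (map (\<lambda>m. charset \<alpha> ! \<sigma> m) [0..<n]) u00 t)))
     \<and>
     (\<forall>(q::nat \<Rightarrow> real) (r::midx \<Rightarrow> real) (Mq::nat \<Rightarrow> 'v \<Rightarrow> 'w).
        (\<forall>k. q k > 0) \<and> summable (\<lambda>k. (q k)\<^sup>2 * (C k)\<^sup>2) \<and> suminf (\<lambda>k. (q k)\<^sup>2 * (C k)\<^sup>2) < 1 \<and>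
        r = (\<lambda>\<alpha>. mpow q \<alpha> / sqrt (fact (mabs \<alpha>))) \<and> Mq = (\<lambda>k x. q k *\<^sub>R M k x) \<longrightarrow>
        chaos_series \<xi> (\<lambda>\<alpha> t. j (u \<alpha> t)) \<in> RL2 \<xi> r (calV e T) (calV_norm e T)
        \<and>
        (\<forall>n\<ge>1. \<forall>t\<in>{0..T}.
           chaos_series \<xi> (\<lambda>\<alpha>. if mabs \<alpha> = n then mpow q \<alpha> *\<^sub>R j (u \<alpha> t) else 0)
           = chaos_series \<xi> (\<lambda>\<alpha>. iter_delta e T A Mq u00 n \<alpha> t))
        \<and>
        (\<forall>t\<in>{0..T}.
           (\<forall>\<alpha>. summable (\<lambda>n. (1 / sqrt (fact (Suc n))) *\<^sub>R iter_delta e T A Mq u00 (Suc n) \<alpha> t)) \<and>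
           chaos_series \<xi> (\<lambda>\<alpha>. r \<alpha> *\<^sub>R j (u \<alpha> t))
           = chaos_series \<xi> (\<lambda>\<alpha>. (if \<alpha> = 0 then u00 t else 0)
               + suminf (\<lambda>n. (1 / sqrt (fact (Suc n))) *\<^sub>R iter_delta e T A Mq u00 (Suc n) \<alpha> t)))
        \<and>
        (let remainder = (\<lambda>N. chaos_series \<xi> (\<lambda>\<alpha> t. r \<alpha> *\<^sub>R j (u \<alpha> t)
               - ((if \<alpha> = 0 then u00 t else 0)
                  + (\<Sum>n=1..N. (1 / sqrt (fact n)) *\<^sub>R iter_delta e T A Mq u00 n \<alpha> t))))
         in (\<forall>N. remainder N \<in> RL2 \<xi> (\<lambda>_. 1) (calV e T) (calV_norm e T)) \<and>
            (\<lambda>N. RL2_norm (\<lambda>_. 1) (calV_norm e T) (remainder N)) \<longlonglongrightarrow> 0))"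
proof -
  have "bounded_linear i" "inj i" "bounded_linear j" "inj j"
    using triple by (auto simp: normal_triple_def)
  then have lin_e: "linear e" and inj_e: "inj e"
    unfolding e by (auto simp: linear_compose bounded_linear.linear intro: inj_compose)
  have j0: "j 0 = 0"
    using \<open>bounded_linear j\<close> by (simp add: linear_0 bounded_linear.linear)
  interpret evolution_equation e T A
  proof (rule evolution_equation.intro)
    show "\<exists>w. evol_solution e T A 0 F w" if "F \<in> L2_time T" for F
      using A(2) that j0 unfolding assumption_A_def e by metis
    obtain K where K: "\<And>U0 F w. F \<in> L2_time T \<Longrightarrow> evol_solution e T A (j U0) F w
        \<Longrightarrow> calV_norm e T w \<le> K * (norm U0 + L2_time_norm T F)"
      using A(2) unfolding assumption_A_def e by metis
    \<comment> \<open>With both data zero the a priori estimate reads norm \<le> 0, and the norm is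
      nonnegative.\<close>
    show "calV_norm e T w = 0" if "evol_solution e T A 0 (\<lambda>s. 0) w" for w
      using K[OF L2_time_zero, of 0 w] that
      by (simp add: j0 L2_time_norm_zero) (simp add: calV_norm_def L2_time_norm_def order_antisym)
  qed (fact lin_e inj_e A(1))+

  define ju where "ju = (\<lambda>\<alpha> t. j (u \<alpha> t))"
  \<comment> \<open>The equations determine \<open>u\<close> only on [0,T]; setting it to 0
    elsewhere makes the coefficients equal to the normalised functions that \<open>duhamel\<close>
    returns.\<close>
  define w where "w = (\<lambda>\<alpha> t. if t \<in> {0..T} then ju \<alpha> t else 0)"
  have ju: "ju \<alpha> \<in> calV e T" for \<alpha>
    using u by (simp add: spde_solution_def e ju_def)
  have w_eq: "w \<alpha> t = ju \<alpha> t" if "t \<in> {0..T}" for \<alpha> t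
    using that by (simp add: w_def)
  have w: "w \<alpha> \<in> calV e T" for \<alpha>
    using ju by (rule calV_cong) (simp add: w_eq)
  have toV_w: "toV e (w \<alpha>) t = toV e (ju \<alpha>) t" if "t \<in> {0..T}" for \<alpha> t
    using that by (simp add: toV_def w_eq)
  \<comment> \<open>Each coefficient solves an evolution equation of its own once the coupling term
    \<delta> is counted as part of the source.\<close>
  have sol: "evol_solution e T A (if \<alpha> = 0 then j u0 else 0)
      (\<lambda>s. (if \<alpha> = 0 then f s else 0) + delta M (\<lambda>\<beta>. toV e (w \<beta>) s) \<alpha>) (w \<alpha>)" for \<alpha>
  proof (rule evol_solution_cong_AE[OF _ _ w_eq])
    show "evol_solution e T A (if \<alpha> = 0 then j u0 else 0)
      (\<lambda>s. (if \<alpha> = 0 then f s else 0) + delta M (\<lambda>\<beta>. toV e (ju \<beta>) s) \<alpha>) (ju \<alpha>)"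
      using u ju by (simp add: spde_solution_def evol_solution_def e ju_def add.assoc)
    show "AE s in time_measure T. (if \<alpha> = 0 then f s else 0) + delta M (\<lambda>\<beta>. toV e (ju \<beta>) s) \<alpha>
        = (if \<alpha> = 0 then f s else 0) + delta M (\<lambda>\<beta>. toV e (w \<beta>) s) \<alpha>"
      by (rule AE_time_measureI) (simp add: toV_w)
  qed
  have outside: "w \<alpha> t = 0" if "t \<notin> {0..T}" for \<alpha> t
    using that by (auto simp: w_def)
  \<comment> \<open>At \<alpha> = 0 the sum in \<open>delta\<close> is empty, which leaves the
    deterministic equation with data \<open>u0\<close> and \<open>f\<close>.\<close>
  have w0: "w 0 = u00"
    using duhamel_eqI[OF sol outside, of 0] by (simp add: u00 delta_def)
  interpret chaos_coefficients e T A M w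
  proof (intro chaos_coefficients.intro chaos_coefficients_axioms.intro)
    show "w \<alpha> = Phi_conv e T A (\<lambda>s. delta M (\<lambda>\<beta>. toV e (w \<beta>) s) \<alpha>)" if "\<alpha> \<noteq> 0" for \<alpha>
      using duhamel_eqI[OF sol outside, of \<alpha>] that by (simp add: Phi_conv_def)
  qed (fact evolution_equation_axioms M w)+

  have part1: "j (u \<alpha> t) = (1 / sqrt (mfact \<alpha>)) *\<^sub>R (\<Sum>\<sigma>\<in>{\<sigma>. \<sigma> permutes {..<mabs \<alpha>}}.
      iter_int e T A M (map (\<lambda>m. charset \<alpha> ! \<sigma> m) [0..<mabs \<alpha>]) u00 t)"
    if t: "t \<in> {0..T}" for \<alpha> t
  proof -
    have "j (u \<alpha> t) = w \<alpha> t"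
      using t by (simp add: w_eq ju_def)
    also have "\<dots> = sqrt (mfact \<alpha>) *\<^sub>R
        (\<Sum>ys\<in>permutations_of_multiset (mset (charset \<alpha>)). iter_int e T A M ys u00 t)"
      by (subst w_eq_sum_iter_int) (simp add: w0)
    \<comment> \<open>The permutation sum counts every rearrangement \<alpha>! times, which accounts
      for the normalisation 1/\<surd>\<alpha>! in the claim.\<close>
    also have "sqrt (mfact \<alpha>) = 1 / sqrt (mfact \<alpha>) * mfact \<alpha>"
      using mfact_pos[of \<alpha>] by (simp add: real_div_sqrt)
    finally show ?thesis
      unfolding sum_charset_permutations[of "\<lambda>ks. iter_int e T A M ks u00 t"] by simp
  qed

  have part23:
    "chaos_series \<xi> ju \<in> RL2 \<xi> r (calV e T) (calV_norm e T)" (is ?membership)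
    "\<forall>n\<ge>1. \<forall>t\<in>{0..T}. chaos_series \<xi> (\<lambda>\<alpha>. if mabs \<alpha> = n then mpow q \<alpha> *\<^sub>R ju \<alpha> t else 0)
       = chaos_series \<xi> (\<lambda>\<alpha>. iter_delta e T A Mq u00 n \<alpha> t)" (is ?levels)
    "\<forall>t\<in>{0..T}.
       (\<forall>\<alpha>. summable (\<lambda>n. (1 / sqrt (fact (Suc n))) *\<^sub>R iter_delta e T A Mq u00 (Suc n) \<alpha> t)) \<and>
       chaos_series \<xi> (\<lambda>\<alpha>. r \<alpha> *\<^sub>R ju \<alpha> t)
       = chaos_series \<xi> (\<lambda>\<alpha>. (if \<alpha> = 0 then u00 t else 0)
           + suminf (\<lambda>n. (1 / sqrt (fact (Suc n))) *\<^sub>R iter_delta e T A Mq u00 (Suc n) \<alpha> t))" (is ?expansion)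
    "let remainder = (\<lambda>N. chaos_series \<xi> (\<lambda>\<alpha> t. r \<alpha> *\<^sub>R ju \<alpha> t
           - ((if \<alpha> = 0 then u00 t else 0)
              + (\<Sum>n=1..N. (1 / sqrt (fact n)) *\<^sub>R iter_delta e T A Mq u00 n \<alpha> t))))
     in (\<forall>N. remainder N \<in> RL2 \<xi> (\<lambda>_. 1) (calV e T) (calV_norm e T)) \<and>
        (\<lambda>N. RL2_norm (\<lambda>_. 1) (calV_norm e T) (remainder N)) \<longlonglongrightarrow> 0" (is ?convergence)
    if q: "\<forall>k. q k > 0" and summ: "summable (\<lambda>k. (q k)\<^sup>2 * (C k)\<^sup>2)"
      and lt1: "suminf (\<lambda>k. (q k)\<^sup>2 * (C k)\<^sup>2) < 1"
      and r: "r = (\<lambda>\<alpha>. mpow q \<alpha> / sqrt (fact (mabs \<alpha>)))" and Mq: "Mq = (\<lambda>k x. q k *\<^sub>R M k x)"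
    for q :: "nat \<Rightarrow> real" and r Mq
  proof -
    define x where "x = (\<lambda>k. (q k)\<^sup>2 * (C k)\<^sup>2)"
    define B where "B = (\<lambda>\<alpha>. (r \<alpha>)\<^sup>2 * (calV_norm e T (w \<alpha>))\<^sup>2)"
    have B_nonneg: "0 \<le> B \<alpha>" and x_nonneg: "0 \<le> x k" for \<alpha> k
      by (simp_all add: B_def x_def)
    have B_le: "B \<alpha> \<le> (\<Sum>k\<in>Poly_Mapping.keys \<alpha>. x k * B (\<alpha> - meps k))" if "\<alpha> \<noteq> 0" for \<alpha>
      unfolding B_def x_def r by (rule weighted_norm_le[OF C that])
    have \<rho>: "0 \<le> suminf x" "suminf x < 1"
      using summ lt1 by (simp_all add: x_def suminf_nonneg)
    have tail: "sum B F \<le> suminf x ^ m / (1 - suminf x) * B 0"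
      if "finite F" "\<And>\<alpha>. \<alpha> \<in> F \<Longrightarrow> m \<le> mabs \<alpha>" for F m
      using summ \<rho>(2) that by (intro sum_tail_le[OF B_nonneg x_nonneg _ B_le]) (simp_all add: x_def)
    \<comment> \<open>The tail bound with m = 0 bounds all finite partial sums uniformly.\<close>
    have "B summable_on UNIV"
      by (rule nonneg_bdd_above_summable_on[OF B_nonneg])
        (auto intro!: bdd_aboveI2[where M = "suminf x ^ 0 / (1 - suminf x) * B 0"] tail simp del: power_0)
    then have B_summable: "B summable_on S" for S
      using summable_on_subset_banach by blast

    have delta_eq: "iter_delta e T A Mq u00 n \<alpha> t = (if mabs \<alpha> = n then mpow q \<alpha> *\<^sub>R w \<alpha> t else 0)"
      for n \<alpha> t
      using iter_delta_eq[of q n] by (simp add: Mq w0)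
    have r0: "r 0 = 1"
      by (simp add: r mpow_zero mabs_zero)

    have norm_ju: "calV_norm e T (ju \<alpha>) = calV_norm e T (w \<alpha>)" for \<alpha>
      by (rule calV_norm_cong[symmetric, OF ju]) (simp add: w_eq)
    show ?membership
      unfolding RL2_def using ju B_summable[of UNIV] by (auto simp: norm_ju B_def)
    show ?levels
      by (simp add: delta_eq w_eq cong: if_cong)
    show ?expansion
    proof (intro ballI)
      fix t assume t: "t \<in> {0..T}"
      let ?g = "\<lambda>\<alpha> n. (1 / sqrt (fact (Suc n))) *\<^sub>R iter_delta e T A Mq u00 (Suc n) \<alpha> t"
      \<comment> \<open>For fixed \<alpha> \<noteq> 0 only the term with n + 1 = |\<alpha>|
        survives, so the coefficient series has a single entry. The zero multi-index gets nothing
        from the series, and its coefficient is \<open>u00\<close> alone.\<close>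
      have sums: "?g \<alpha> sums (if \<alpha> = 0 then 0 else r \<alpha> *\<^sub>R w \<alpha> t)" for \<alpha>
      proof (cases "\<alpha> = 0")
        case True
        then show ?thesis by (simp add: delta_eq mabs_zero)
      next
        case False
        then obtain m where m: "mabs \<alpha> = Suc m"
          using mabs_eq_0_iff not0_implies_Suc by blast
        have "?g \<alpha> = (\<lambda>n. if n = m then r \<alpha> *\<^sub>R w \<alpha> t else 0)"
          by (auto simp: delta_eq m r fun_eq_iff)
        then show ?thesis
          using False sums_single[of m "\<lambda>_. r \<alpha> *\<^sub>R w \<alpha> t"] by simp
      qed
      have "r \<alpha> *\<^sub>R ju \<alpha> t = (if \<alpha> = 0 then u00 t else 0) + suminf (?g \<alpha>)" for \<alpha>
        using sums_unique[OF sums, of \<alpha>] t by (auto simp: w_eq r0 w0[symmetric])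
      then show "(\<forall>\<alpha>. summable (?g \<alpha>)) \<and> chaos_series \<xi> (\<lambda>\<alpha>. r \<alpha> *\<^sub>R ju \<alpha> t)
         = chaos_series \<xi> (\<lambda>\<alpha>. (if \<alpha> = 0 then u00 t else 0) + suminf (?g \<alpha>))"
        using sums_summable[OF sums] by simp
    qed

    define R where "R = (\<lambda>N \<alpha> t. r \<alpha> *\<^sub>R ju \<alpha> t - ((if \<alpha> = 0 then u00 t else 0)
              + (\<Sum>n=1..N. (1 / sqrt (fact n)) *\<^sub>R iter_delta e T A Mq u00 n \<alpha> t)))"
    \<comment> \<open>On [0,T] the partial sum removes exactly the levels up to N, level 0 being
      removed by \<open>u00\<close>. Values outside [0,T] may differ, which affects neither
      membership in \<open>calV\<close> nor the norm.\<close>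
    have R_eq: "R N \<alpha> t = (if N < mabs \<alpha> then r \<alpha> *\<^sub>R w \<alpha> t else 0)" if t: "t \<in> {0..T}" for N \<alpha> t
    proof -
      have "(\<Sum>n=1..N. (1 / sqrt (fact n)) *\<^sub>R iter_delta e T A Mq u00 n \<alpha> t)
          = (\<Sum>n=1..N. if n = mabs \<alpha> then r \<alpha> *\<^sub>R w \<alpha> t else 0)"
        by (rule sum.cong) (auto simp: delta_eq r)
      also have "\<dots> = (if mabs \<alpha> \<in> {1..N} then r \<alpha> *\<^sub>R w \<alpha> t else 0)"
        by simp
      finally show ?thesis
        using t mabs_eq_0_iff[of \<alpha>] by (auto simp: R_def w_eq r0 w0[symmetric] mabs_zero)
    qed
    have rw: "(\<lambda>t. if N < mabs \<alpha> then r \<alpha> *\<^sub>R w \<alpha> t else 0) \<in> calV e T" for N \<alpha>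
      by (cases "N < mabs \<alpha>") (simp_all add: calV_scaleR w calV_zero)
    have R: "R N \<alpha> \<in> calV e T"
      and R_norm: "(calV_norm e T (R N \<alpha>))\<^sup>2 = (if N < mabs \<alpha> then B \<alpha> else 0)" for N \<alpha>
      using calV_cong[OF rw R_eq] calV_norm_cong[OF rw R_eq, of N \<alpha>]
      by (auto simp: B_def calV_norm_scaleR w calV_norm_zero power_mult_distrib)
    have R_summable: "(\<lambda>\<alpha>. (calV_norm e T (R N \<alpha>))\<^sup>2) summable_on UNIV" for N
      by (rule summable_on_comparison_test[OF B_summable]) (auto simp: R_norm B_nonneg)
    \<comment> \<open>The squared remainder norm is the part of the sum of \<open>B\<close> above
      level N, so the tail bound with m = N controls it and tends to 0.\<close>
    have le: "(\<Sum>\<^sub>\<infinity>\<alpha>. (calV_norm e T (R N \<alpha>))\<^sup>2) \<le> suminf x ^ N / (1 - suminf x) * B 0" for N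
    proof (rule infsum_le_finite_sums[OF R_summable])
      fix F :: "midx set" assume F: "finite F"
      have "(\<Sum>\<alpha>\<in>F. (calV_norm e T (R N \<alpha>))\<^sup>2) = sum B {\<alpha>\<in>F. N < mabs \<alpha>}"
        using F by (simp add: R_norm sum.inter_filter)
      also have "\<dots> \<le> suminf x ^ N / (1 - suminf x) * B 0"
        using F by (intro tail) auto
      finally show "(\<Sum>\<alpha>\<in>F. (calV_norm e T (R N \<alpha>))\<^sup>2) \<le> suminf x ^ N / (1 - suminf x) * B 0" .
    qed
    have "(\<lambda>N. suminf x ^ N / (1 - suminf x) * B 0) \<longlonglongrightarrow> 0 / (1 - suminf x) * B 0"
      using \<rho> by (intro tendsto_intros LIMSEQ_realpow_zero) auto
    then have lim: "(\<lambda>N. suminf x ^ N / (1 - suminf x) * B 0) \<longlonglongrightarrow> 0"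
      by simp
    have "(\<lambda>N. \<Sum>\<^sub>\<infinity>\<alpha>. (calV_norm e T (R N \<alpha>))\<^sup>2) \<longlonglongrightarrow> 0"
    proof (rule tendsto_sandwich[OF _ _ tendsto_const lim])
      show "\<forall>\<^sub>F N in sequentially. 0 \<le> (\<Sum>\<^sub>\<infinity>\<alpha>. (calV_norm e T (R N \<alpha>))\<^sup>2)"
        by (intro always_eventually allI infsum_nonneg) simp
      show "\<forall>\<^sub>F N in sequentially. (\<Sum>\<^sub>\<infinity>\<alpha>. (calV_norm e T (R N \<alpha>))\<^sup>2)
          \<le> suminf x ^ N / (1 - suminf x) * B 0"
        by (intro always_eventually allI le)
    qed
    then have "(\<lambda>N. sqrt (\<Sum>\<^sub>\<infinity>\<alpha>. (calV_norm e T (R N \<alpha>))\<^sup>2)) \<longlonglongrightarrow> sqrt 0"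
      by (rule tendsto_real_sqrt)
    then have "(\<lambda>N. RL2_norm (\<lambda>_. 1) (calV_norm e T) (chaos_series \<xi> (R N))) \<longlonglongrightarrow> 0"
      by (simp add: RL2_norm_def chaos_series_def)
    moreover have "\<forall>N. chaos_series \<xi> (R N) \<in> RL2 \<xi> (\<lambda>_. 1) (calV e T) (calV_norm e T)"
      unfolding RL2_def using R R_summable by auto
    ultimately show ?convergence
      unfolding Let_def R_def by (intro conjI)
  qed

  show ?thesis
  proof (rule conjI, goal_cases)
    case 1
    show ?case using part1 by blast
  next
    case 2
    show ?case
    proof (intro allI impI, elim conjE, goal_cases)
      case (1 q r Mq)
      show ?case
        using part23[OF 1] unfolding ju_def by (intro conjI)
    qed
  qed
qed

end
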